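(* For any $p\in(0,1]$, the distributionally robust two-stage risk-averse stochastic program $$\mathop{\text{minimize}}_{\bm{x}\in\mathcal{X}}\; c(\bm{x})+\sup_{\mathbb{P}\in\mathcal{P}}\mathbb{P}\text{-CVaR}_p\left[\mathcal{Q}(\bm{x},\tilde{\bm{\xi}})\right]$$ is equivalent to the problem $$\mathop{\text{minimize}}_{\bm{x}\in\mathcal{X},\,\alpha\geq0,\,w\in\mathbb{R}}\; c(\bm{x})+\alpha\varepsilon+w+\frac1N\sum_{i=1}^N Z_i(\bm{x},\alpha,w),$$ where, for each $i\in\{1,\ldots,N\}$, the function $Z_i:\mathcal{X}\times\mathbb{R}_+\times\mathbb{R}\to\mathbb{R}$ and the set $\mathcal{Z}_i$ are defined by $$Z_i(\bm{x},\alpha,w)=\mathop{\text{maximize}}_{(\bm{\xi},\bm{\lambda},\bm{\Lambda},\tau,\theta)\in\mathrm{cl\,conv}(\mathcal{Z}_i)}\left\{\langle\bm{T}(\bm{x}),\bm{\Lambda}\rangle+\bm{h}(\bm{x})^\top\bm{\lambda}-w\theta-\alpha\tau\right\},$$ $$\mathcal{Z}_i=\left\{(\bm{\xi},\bm{\lambda},\bm{\Lambda},\tau,\theta)\in\Xi\times\mathbb{R}^L_+\times\mathbb{R}^{L\times M}\times\mathbb{R}_+\times[0,p^{-1}] : \begin{array}{l}\bm{\Lambda}=\bm{\lambda}\bm{\xi}^\top,\;(\bm{\xi}-\hat{\bm{\xi}}^{(i)},\tau)\in\mathcal{C}^{M+1},\\ (\bm{q}_0+\bm{Q}\bm{\x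i})\theta-\bm{W}_0^\top\bm{\lambda}-\sum_{j=1}^M\bm{W}_j^\top\bm{\Lambda}\mathbf{e}_j\in\mathcal{Y}^*\end{array}\right\}.$$
   Context: Equivalence means: for every fixed $\bm{x}\in\mathcal{X}$, the infimum of the second objective over the remaining variables equals the first objective at $\bm{x}$ (in particular the optimal values coincide). "maximize" denotes the supremum value. The conditional value-at-risk is $\mathbb{P}\text{-CVaR}_p[\mathcal{Q}(\bm{x},\tilde{\bm{\xi}})]=\inf_{w\in\mathbb{R}} w+\frac1p\mathbb{E}_{\mathbb{P}}[\max\{\mathcal{Q}(\bm{x},\tilde{\bm{\xi}})-w,0\}]$. Setting. $\Xi\subseteq\{0,1\}^M$ is the support; $\hat{\bm{\xi}}^{(1)},\ldots,\hat{\bm{\xi}}^{(N)}\in\Xi$ are given observations; $\hat{\mathbb{P}}_N=\frac1N\sum_{i=1}^N\delta_{\hat{\bm{\xi}}^{(i)}}$. $\mathcal{X}\subseteq\mathbb{R}^{N_1}$ is convex and compact, $c:\mathcal{X}\to\mathbb{R}$ is convex. The second-stage loss is $\mathcal{Q}(\bm{x},\bm{\xi})=\inf_{\bm{y}\in\mathcal{Y}}\{\bm{q}(\bm{\xi})^\top\bm{y}:\bm{W}(\bm{\xi})\bm{y}\geq\bm{T}(\bm{x})\bm{\xi}+\bm{h}(\bm{x})\}$, where $\mathcal{Y}\subseteq\mathbb{R}^{N_2}$ is a proper cone (closed, convex, pointed, full-dimensional) with dual cone $\mathcal{Y}^*$; $\bm{q}(\bm{\xi})=\bm{q}_0+\bm{Q}\bm{\xi}$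 with $\bm{Q}\in\mathbb{R}^{N_2\times M}$; $\bm{W}(\bm{\xi})=\bm{W}_0+\sum_{j=1}^M\xi_j\bm{W}_j$ with $\bm{W}_j\in\mathbb{R}^{L\times N_2}$; $\bm{h}:\mathcal{X}\to\mathbb{R}^L$, $\bm{T}:\mathcal{X}\to\mathbb{R}^{L\times M}$ are componentwise closed, proper, convex. Ambiguity set. $\mathcal{P}=\{\mathbb{Q}\in\mathcal{M}(\Xi):d_W(\mathbb{Q},\hat{\mathbb{P}}_N)\leq\varepsilon\}$, $\varepsilon\geq0$, where $\mathcal{M}(\Xi)$ is the set of distributions on $\Xi$, $d_W(\mathbb{P},\mathbb{P}')=\min_\Pi\sum_{\bm{\xi},\bm{\xi}'\in\Xi}d(\bm{\xi},\bm{\xi}')\Pi(\bm{\xi},\bm{\xi}')$ over couplings $\Pi$ of $\mathbb{P},\mathbb{P}'$, $d(\bm{\xi},\bm{\xi}')=\|\bm{\xi}-\bm{\xi}'\|$ is induced by an arbitrary norm on $\mathbb{R}^M$, and $\mathcal{C}^{M+1}=\{(\bm{v},t)\in\mathbb{R}^M\times\mathbb{R}:\|\bm{v}\|\leq t\}$. Standing assumptions. (A1) For every $\bm{\xi}\in\Xi$ there exists $\bm{y}^+\in\mathrm{int}(\mathcal{Y})$ with $\bm{W}(\bm{\xi})\bm{y}^+>0$. (A2) $\mathcal{Q}(\bm{x},\bm{\xi})$ is bounded (finite) for every $\bm{x}\in\mathcal{X}$, $\bm{\xi}\in\Xi$. Notation. $\langle\bm{A},\bm{B}\rangle=\sum_{i,j}A_{ij}B_{ij}$;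 $\mathbf{e}_j$ is the $j$th unit basis vector; $\mathrm{cl\,conv}$ is the closed convex hull. *)

theory Defs
  imports "HOL-Analysis.Analysis" "HOL-Probability.Probability"
begin

definition is_norm :: "('a::real_vector \<Rightarrow> real) \<Rightarrow> bool" where
  "is_norm nrm \<longleftrightarrow>
     (\<forall>v. 0 \<le> nrm v) \<and>
     (\<forall>v. nrm v = 0 \<longleftrightarrow> v = 0) \<and>
     (\<forall>a v. nrm (a *\<^sub>R v) = \<bar>a\<bar> * nrm v) \<and>
     (\<forall>u v. nrm (u + v) \<le> nrm u + nrm v)"

definition norm_cone :: "('a::real_vector \<Rightarrow> real) \<Rightarrow> ('a \<times> real) set" where
  "norm_cone nrm = {(v, t). nrm v \<le> t}"

definition proper_cone :: "'a::euclidean_space set \<Rightarrow> bool" where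
  "proper_cone K \<longleftrightarrow>
     cone K \<and> closed K \<and> convex K \<and> K \<inter> uminus ` K = {0} \<and> aff_dim K = int DIM('a)"

definition dual_cone :: "'a::real_inner set \<Rightarrow> 'a set" where
  "dual_cone K = {z. \<forall>y\<in>K. 0 \<le> z \<bullet> y}"

text \<open>A function \<open>f : X \<rightarrow> \<real>\<close> is read as the extended-valued function that is \<open>\<infinity>\<close> outside
  \<open>X\<close>: closedness is closedness of its epigraph, and, since \<open>f\<close> is finite on \<open>X\<close>, properness
  amounts to \<open>X \<noteq> {}\<close>.\<close>

definition closed_proper_convex_on :: "'a::euclidean_space set \<Rightarrow> ('a \<Rightarrow> real) \<Rightarrow> bool" where
  "closed_proper_convex_on X f \<longleftrightarrow> closed (epigraph X f) \<and> X \<noteq> {} \<and> convex_on X f"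

definition binary_vectors :: "(real^'m) set" where
  "binary_vectors = {\<xi>. \<forall>j. \<xi> $ j \<in> {0, 1}}"

definition q_of :: "real^'n \<Rightarrow> real^'m^'n \<Rightarrow> real^'m \<Rightarrow> real^'n" where
  "q_of q0 Q \<xi> = q0 + Q *v \<xi>"

definition W_of :: "real^'n^'l \<Rightarrow> ('m::finite \<Rightarrow> real^'n^'l) \<Rightarrow> real^'m \<Rightarrow> real^'n^'l" where
  "W_of W0 W \<xi> = W0 + (\<Sum>j\<in>UNIV. (\<xi> $ j) *\<^sub>R W j)"

text \<open>Extended-valued, so that an infeasible or unbounded second stage gives \<open>\<infinity>\<close> or \<open>-\<infinity>\<close>.\<close>

definition second_stage ::
  "(real^'n) set \<Rightarrow> real^'n \<Rightarrow> real^'m^'n \<Rightarrow> real^'n^'l \<Rightarrow> ('m::finite \<Rightarrow> real^'n^'l) \<Rightarrow>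
   (real^'k \<Rightarrow> real^'m^'l) \<Rightarrow> (real^'k \<Rightarrow> real^'l) \<Rightarrow> real^'k \<Rightarrow> real^'m \<Rightarrow> ereal" where
  "second_stage Y q0 Q W0 W T h x \<xi> =
     (INF y\<in>{y\<in>Y. \<forall>l. (T x *v \<xi> + h x) $ l \<le> (W_of W0 W \<xi> *v y) $ l}.
        ereal (q_of q0 Q \<xi> \<bullet> y))"

definition empirical_pmf :: "nat \<Rightarrow> (nat \<Rightarrow> 'a) \<Rightarrow> 'a pmf" where
  "empirical_pmf N xh = map_pmf xh (pmf_of_set {1..N})"

text \<open>For finite \<open>S\<close> carrying \<open>P\<close> and \<open>P'\<close> the infimum is over a nonempty set of nonnegative
  reals and is attained, so it is a minimum.\<close>

definition wasserstein ::
  "'a set \<Rightarrow> ('a \<Rightarrow> 'a \<Rightarrow> real) \<Rightarrow> 'a pmf \<Rightarrow> 'a pmf \<Rightarrow> real" where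
  "wasserstein S d P P' =
     (INF R\<in>{R. map_pmf fst R = P \<and> map_pmf snd R = P'}.
        \<Sum>\<xi>\<in>S. \<Sum>\<xi>'\<in>S. d \<xi> \<xi>' * pmf R (\<xi>, \<xi>'))"

definition ambiguity_set ::
  "('a::real_vector \<Rightarrow> real) \<Rightarrow> 'a set \<Rightarrow> nat \<Rightarrow> (nat \<Rightarrow> 'a) \<Rightarrow> real \<Rightarrow> 'a pmf set" where
  "ambiguity_set nrm S N xh \<epsilon> =
     {P. set_pmf P \<subseteq> S \<and>
         wasserstein S (\<lambda>\<xi> \<xi>'. nrm (\<xi> - \<xi>')) P (empirical_pmf N xh) \<le> \<epsilon>}"

definition cvar :: "'a pmf \<Rightarrow> real \<Rightarrow> ('a \<Rightarrow> real) \<Rightarrow> ereal" where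
  "cvar P p X =
     (INF w. ereal (w + 1 / p * measure_pmf.expectation P (\<lambda>\<xi>. max (X \<xi> - w) 0)))"

text \<open>\<open>real_of_ereal\<close> is harmless here: it is applied only to second-stage values that are
  assumed to be finite.\<close>

definition dro_objective ::
  "(real^'m \<Rightarrow> real) \<Rightarrow> (real^'m) set \<Rightarrow> nat \<Rightarrow> (nat \<Rightarrow> real^'m) \<Rightarrow> real \<Rightarrow> real \<Rightarrow>
   (real^'n) set \<Rightarrow> real^'n \<Rightarrow> real^'m^'n \<Rightarrow> real^'n^'l \<Rightarrow> ('m::finite \<Rightarrow> real^'n^'l) \<Rightarrow>
   (real^'k \<Rightarrow> real^'m^'l) \<Rightarrow> (real^'k \<Rightarrow> real^'l) \<Rightarrow> (real^'k \<Rightarrow> real) \<Rightarrow> real^'k \<Rightarrow> ereal" where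
  "dro_objective nrm \<Xi> N xh \<epsilon> p Y q0 Q W0 W T h c x =
     ereal (c x) +
     (SUP P\<in>ambiguity_set nrm \<Xi> N xh \<epsilon>.
        cvar P p (\<lambda>\<xi>. real_of_ereal (second_stage Y q0 Q W0 W T h x \<xi>)))"

text \<open>The argument \<open>\<xi>0\<close> is the observation \<open>\<xi>\<close>-hat indexing the set.\<close>

definition Z_set ::
  "(real^'m \<Rightarrow> real) \<Rightarrow> (real^'m) set \<Rightarrow> real^'m \<Rightarrow> real \<Rightarrow>
   (real^'n) set \<Rightarrow> real^'n \<Rightarrow> real^'m^'n \<Rightarrow> real^'n^'l \<Rightarrow> ('m::finite \<Rightarrow> real^'n^'l) \<Rightarrow>
   ((real^'m) \<times> (real^'l) \<times> (real^'m^'l) \<times> real \<times> real) set" where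
  "Z_set nrm \<Xi> \<xi>0 p Y q0 Q W0 W =
     {(\<xi>, lam, Lam, \<tau>, \<theta>).
        \<xi> \<in> \<Xi> \<and> (\<forall>l. 0 \<le> lam $ l) \<and> 0 \<le> \<tau> \<and> \<theta> \<in> {0..1 / p} \<and>
        Lam = (\<chi> l j. lam $ l * \<xi> $ j) \<and>
        (\<xi> - \<xi>0, \<tau>) \<in> norm_cone nrm \<and>
        \<theta> *\<^sub>R (q0 + Q *v \<xi>) - transpose W0 *v lam
          - (\<Sum>j\<in>UNIV. transpose (W j) *v (Lam *v axis j 1)) \<in> dual_cone Y}"

text \<open>On matrices \<open>\<bullet>\<close> is the entrywise (trace) inner product.\<close>

definition Z_fun ::
  "(real^'m \<Rightarrow> real) \<Rightarrow> (real^'m) set \<Rightarrow> real^'m \<Rightarrow> real \<Rightarrow>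
   (real^'n) set \<Rightarrow> real^'n \<Rightarrow> real^'m^'n \<Rightarrow> real^'n^'l \<Rightarrow> ('m::finite \<Rightarrow> real^'n^'l) \<Rightarrow>
   (real^'k \<Rightarrow> real^'m^'l) \<Rightarrow> (real^'k \<Rightarrow> real^'l) \<Rightarrow> real^'k \<Rightarrow> real \<Rightarrow> real \<Rightarrow> ereal" where
  "Z_fun nrm \<Xi> \<xi>0 p Y q0 Q W0 W T h x \<alpha> w =
     (SUP (\<xi>, lam, Lam, \<tau>, \<theta>) \<in> closure (convex hull (Z_set nrm \<Xi> \<xi>0 p Y q0 Q W0 W)).
        ereal (T x \<bullet> Lam + h x \<bullet> lam - w * \<theta> - \<alpha> * \<tau>))"

definition reformulated_objective ::
  "(real^'m \<Rightarrow> real) \<Rightarrow> (real^'m) set \<Rightarrow> nat \<Rightarrow> (nat \<Rightarrow> real^'m) \<Rightarrow> real \<Rightarrow> real \<Rightarrow>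
   (real^'n) set \<Rightarrow> real^'n \<Rightarrow> real^'m^'n \<Rightarrow> real^'n^'l \<Rightarrow> ('m::finite \<Rightarrow> real^'n^'l) \<Rightarrow>
   (real^'k \<Rightarrow> real^'m^'l) \<Rightarrow> (real^'k \<Rightarrow> real^'l) \<Rightarrow> (real^'k \<Rightarrow> real) \<Rightarrow>
   real^'k \<Rightarrow> real \<Rightarrow> real \<Rightarrow> ereal" where
  "reformulated_objective nrm \<Xi> N xh \<epsilon> p Y q0 Q W0 W T h c x \<alpha> w =
     ereal (c x + \<alpha> * \<epsilon> + w) +
     ereal (1 / real N) * (\<Sum>i=1..N. Z_fun nrm \<Xi> (xh i) p Y q0 Q W0 W T h x \<alpha> w)"

end

theory Submission
  imports Defs
begin

text \<open>
  Fix \<open>x\<close> and let \<open>V \<xi>\<close> be the second-stage value. Both sides are compared with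
  the infimum over \<open>\<alpha> \<ge> 0\<close> and \<open>w\<close> of
  \<open>\<alpha> * \<epsilon> + w\<close> plus the empirical mean over \<open>\<xi>0\<close> of
  \<open>Max\<^sub>\<xi> (max (V \<xi> - w) 0 / p - \<alpha> * nrm (\<xi> - \<xi>0))\<close>.

  On the primal side, the Lagrangian of the transport budget is affine in the transport plan, which
  ranges over a compact convex set, and jointly convex in \<open>(\<alpha>, w)\<close>. One application of a minimax
  theorem thus exchanges the supremum over plans with both the dual variable \<open>\<alpha>\<close> and the
  variable \<open>w\<close> of the conditional value-at-risk.

  On the other side, a linear function has the same supremum over a set and over its closed convex
  hull. For fixed \<open>\<xi>\<close> the constraints on \<open>(\<lambda>, \<theta>)\<close> are those of the conic dual of the
  second stage, homogenized by \<open>\<theta>\<close>, so that strong duality under the Slater condition gives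
  \<open>\<theta> * (V \<xi> - w)\<close>; the maximum over \<open>\<theta> \<in> [0, 1 / p]\<close> produces the positive part.
\<close>

subsection \<open>A minimax theorem\<close>

text \<open>Separation in the plane: the pairs dominated by some \<open>(f R, g R)\<close> form a
  convex set by \<open>conc\<close>, and \<open>alt\<close> keeps it off the open quadrant above
  \<open>(v, v)\<close>. The normal of a separating line has nonnegative entries; normalized to sum
  one, they are the weights \<open>1 - t\<close> and \<open>t\<close>.\<close>

lemma two_function_alternative:
  fixes f g :: "'c \<Rightarrow> real"
  assumes conc: "\<And>R R' t. R \<in> C \<Longrightarrow> R' \<in> C \<Longrightarrow> 0 \<le> t \<Longrightarrow> t \<le> 1 \<Longrightarrow>
      \<exists>S\<in>C. (1 - t) * f R + t * f R' \<le> f S \<and> (1 - t) * g R + t * g R' \<le> g S"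
    and alt: "\<And>R. R \<in> C \<Longrightarrow> f R \<le> v \<or> g R \<le> v"
  shows "\<exists>t. 0 \<le> t \<and> t \<le> 1 \<and> (\<forall>R\<in>C. (1 - t) * f R + t * g R \<le> v)"
proof (cases "C = {}")
  case True
  then show ?thesis by (auto intro: exI[of _ 0])
next
  case False
  then obtain R0 where R0: "R0 \<in> C" by blast
  \<comment> \<open>Closing the image downwards makes it convex, although \<open>conc\<close> only
    yields a dominating point \<open>S\<close>. It also makes \<open>A\<close> unbounded below,
    which fixes the signs of the normal.\<close>
  define A where "A = {(a, b). \<exists>R\<in>C. a \<le> f R \<and> b \<le> g R}"
  define B where "B = {v<..} \<times> {v<..}"
  have "convex A"
    unfolding convex_alt
  proof clarify
    fix a b a' b' t :: real
    assume "(a, b) \<in> A" "(a', b') \<in> A" and t: "0 \<le> t" "t \<le> 1"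
    then obtain R R' where R: "R \<in> C" "a \<le> f R" "b \<le> g R" and R': "R' \<in> C" "a' \<le> f R'" "b' \<le> g R'"
      unfolding A_def by blast
    obtain S where S: "S \<in> C" "(1 - t) * f R + t * f R' \<le> f S" "(1 - t) * g R + t * g R' \<le> g S"
      using conc[OF R(1) R'(1) t] by blast
    have "(1 - t) * a + t * a' \<le> f S" "(1 - t) * b + t * b' \<le> g S"
      using S(2,3) add_mono[OF mult_left_mono[OF R(2), of "1 - t"] mult_left_mono[OF R'(2), of t]]
        add_mono[OF mult_left_mono[OF R(3), of "1 - t"] mult_left_mono[OF R'(3), of t]] t
      by auto
    then show "(1 - t) *\<^sub>R (a, b) + t *\<^sub>R (a', b') \<in> A"
      using S(1) unfolding A_def by auto
  qed
  moreover have "convex B"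
    unfolding B_def by (intro convex_Times convex_real_interval)
  moreover have "A \<noteq> {}" using R0 unfolding A_def by blast
  moreover have "(v + 1, v + 1) \<in> B" unfolding B_def by simp
  then have "B \<noteq> {}" by blast
  moreover have "A \<inter> B = {}"
    using alt unfolding A_def B_def by force
  ultimately obtain n \<beta> where n: "n \<noteq> 0" "\<forall>z\<in>A. n \<bullet> z \<le> \<beta>" "\<forall>z\<in>B. \<beta> \<le> n \<bullet> z"
    using separating_hyperplane_sets by metis
  obtain r s where rs: "n = (r, s)" by (cases n)
  have le: "r * a + s * b \<le> \<beta>" if "R \<in> C" "a \<le> f R" "b \<le> g R" for R a b
    using n(2) that unfolding rs A_def by auto
  have ge: "\<beta> \<le> r * a + s * b" if "v < a" "v < b" for a b
    using n(3) that unfolding rs B_def by auto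
  \<comment> \<open>With a negative \<open>r\<close>, lowering the first coordinate inside
    \<open>A\<close> would push the functional above \<open>\<beta>\<close>.\<close>
  have "0 \<le> r"
  proof (rule ccontr)
    assume "\<not> 0 \<le> r"
    then have "0 < - r" by simp
    obtain k :: nat where "\<beta> - (r * f R0 + s * g R0) < real k * (- r)"
      using ex_less_of_nat_mult[OF \<open>0 < - r\<close>] by blast
    then show False
      using le[OF R0, of "f R0 - real k" "g R0"] by (simp add: algebra_simps)
  qed
  moreover have "0 \<le> s"
  proof (rule ccontr)
    assume "\<not> 0 \<le> s"
    then have "0 < - s" by simp
    obtain k :: nat where "\<beta> - (r * f R0 + s * g R0) < real k * (- s)"
      using ex_less_of_nat_mult[OF \<open>0 < - s\<close>] by blast
    then show False
      using le[OF R0, of "f R0" "g R0 - real k"] by (simp add: algebra_simps)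
  qed
  moreover have "r \<noteq> 0 \<or> s \<noteq> 0" using n(1) rs by (auto simp: zero_prod_def)
  ultimately have pos: "0 < r + s" by linarith
  \<comment> \<open>The corner \<open>(v, v)\<close> is not in the open quadrant, so it is
    approached along the diagonal.\<close>
  have "\<beta> \<le> (r + s) * v"
  proof (rule field_le_epsilon)
    fix e :: real assume "0 < e"
    then have "v < v + e / (r + s)" using pos by simp
    then have "\<beta> \<le> (r + s) * (v + e / (r + s))"
      using ge[of "v + e / (r + s)" "v + e / (r + s)"] by (simp only: distrib_right)
    then show "\<beta> \<le> (r + s) * v + e"
      using pos by (simp only: distrib_left) simp
  qed
  then have "r * f R + s * g R \<le> (r + s) * v" if "R \<in> C" for R
    using le[OF that order_refl order_refl] by linarith
  moreover have "(1 - s / (r + s)) * f R + s / (r + s) * g R = (r * f R + s * g R) / (r + s)" for R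
    using pos by (simp add: divide_simps)
  ultimately have "(1 - s / (r + s)) * f R + s / (r + s) * g R \<le> v" if "R \<in> C" for R
    using that pos by (simp add: pos_divide_le_eq mult.commute)
  then show ?thesis
    using \<open>0 \<le> r\<close> \<open>0 \<le> s\<close> pos by (intro exI[of _ "s / (r + s)"]) auto
qed

text \<open>Induction on \<open>F\<close>, with the domain \<open>C\<close> left general. One
  function \<open>y\<close> is set aside by shrinking \<open>C\<close> to the points where
  \<open>y\<close> fails the bound; the element found there is then merged with \<open>y\<close> by
  the two-function alternative.\<close>

lemma finite_minimax:
  fixes L :: "'z \<Rightarrow> 'c \<Rightarrow> real"
  assumes "finite F" "F \<subseteq> Z" "Z \<noteq> {}"
    and convex_like: "\<And>z z' t. z \<in> Z \<Longrightarrow> z' \<in> Z \<Longrightarrow> 0 \<le> t \<Longrightarrow> t \<le> 1 \<Longrightarrow>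
      \<exists>y\<in>Z. \<forall>R\<in>C. L y R \<le> (1 - t) * L z R + t * L z' R"
    and concave_like: "\<And>R R' t. R \<in> C \<Longrightarrow> R' \<in> C \<Longrightarrow> 0 \<le> t \<Longrightarrow> t \<le> 1 \<Longrightarrow>
      \<exists>S\<in>C. \<forall>z\<in>Z. (1 - t) * L z R + t * L z R' \<le> L z S"
    and none: "\<And>R. R \<in> C \<Longrightarrow> \<exists>z\<in>F. L z R \<le> v"
  shows "\<exists>z\<in>Z. \<forall>R\<in>C. L z R \<le> v"
  using assms
proof (induction F arbitrary: C rule: finite_induct)
  case empty
  then show ?case by (metis empty_iff ex_in_conv)
next
  case (insert y F)
  have y: "y \<in> Z" using insert.prems(1) by simp
  \<comment> \<open>On \<open>C'\<close> the index with value at most \<open>v\<close> must come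
    from \<open>F\<close>. The strict inequality survives convex mixing, so \<open>C'\<close>
    inherits concave-likeness.\<close>
  define C' where "C' = {R \<in> C. v < L y R}"
  have "\<exists>z\<in>Z. \<forall>R\<in>C'. L z R \<le> v"
  proof (rule insert.IH)
    show "F \<subseteq> Z" "Z \<noteq> {}" using insert.prems by auto
    show "\<exists>x\<in>Z. \<forall>R\<in>C'. L x R \<le> (1 - t) * L z R + t * L z' R"
      if "z \<in> Z" "z' \<in> Z" "0 \<le> t" "t \<le> 1" for z z' t
      using insert.prems(3)[OF that] unfolding C'_def by blast
    show "\<exists>S\<in>C'. \<forall>z\<in>Z. (1 - t) * L z R + t * L z R' \<le> L z S"
      if "R \<in> C'" "R' \<in> C'" and t: "0 \<le> t" "t \<le> 1" for R R' t
    proof -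
      have R: "R \<in> C" "R' \<in> C" "v < L y R" "v < L y R'" using that unfolding C'_def by auto
      obtain S where S: "S \<in> C" "\<forall>z\<in>Z. (1 - t) * L z R + t * L z R' \<le> L z S"
        using insert.prems(4)[OF R(1,2) t] by blast
      have "v < (1 - t) * L y R + t * L y R'"
        using convex_bound_lt[of "- L y R" "- v" "- L y R'" "1 - t" t] R(3,4) t by simp
      then have "S \<in> C'" using S y unfolding C'_def by force
      then show ?thesis using S(2) by blast
    qed
    show "\<exists>z\<in>F. L z R \<le> v" if "R \<in> C'" for R
      using insert.prems(5)[of R] that unfolding C'_def by auto
  qed
  then obtain z where z: "z \<in> Z" "\<forall>R\<in>C'. L z R \<le> v" by blast
  \<comment> \<open>Here \<open>z\<close> is small on \<open>C'\<close> and \<open>y\<close> on the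
    rest of \<open>C\<close>; \<open>convex_like\<close> then replaces the mixture of both by a
    single index.\<close>
  have "\<exists>t. 0 \<le> t \<and> t \<le> 1 \<and> (\<forall>R\<in>C. (1 - t) * L z R + t * L y R \<le> v)"
  proof (rule two_function_alternative)
    show "\<exists>S\<in>C. (1 - t) * L z R + t * L z R' \<le> L z S \<and> (1 - t) * L y R + t * L y R' \<le> L y S"
      if "R \<in> C" "R' \<in> C" "0 \<le> t" "t \<le> 1" for R R' t
      using insert.prems(4)[OF that] y z(1) by blast
    show "L z R \<le> v \<or> L y R \<le> v" if "R \<in> C" for R
      using that z(2) unfolding C'_def by force
  qed
  then obtain t where t: "0 \<le> t" "t \<le> 1" "\<forall>R\<in>C. (1 - t) * L z R + t * L y R \<le> v" by blast
  obtain x where "x \<in> Z" "\<forall>R\<in>C. L x R \<le> (1 - t) * L z R + t * L y R"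
    using insert.prems(3)[OF z(1) y t(1,2)] by blast
  then show ?case using t(3) by force
qed

text \<open>A form of Ky Fan's minimax theorem; neither side needs a linear structure.\<close>

lemma minimax:
  fixes L :: "'z \<Rightarrow> 'c::topological_space \<Rightarrow> real"
  assumes "compact C" "Z \<noteq> {}"
    and cont: "\<And>z. z \<in> Z \<Longrightarrow> continuous_on UNIV (L z)"
    and convex_like: "\<And>z z' t. z \<in> Z \<Longrightarrow> z' \<in> Z \<Longrightarrow> 0 \<le> t \<Longrightarrow> t \<le> 1 \<Longrightarrow>
      \<exists>y\<in>Z. \<forall>R\<in>C. L y R \<le> (1 - t) * L z R + t * L z' R"
    and concave_like: "\<And>R R' t. R \<in> C \<Longrightarrow> R' \<in> C \<Longrightarrow> 0 \<le> t \<Longrightarrow> t \<le> 1 \<Longrightarrow>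
      \<exists>S\<in>C. \<forall>z\<in>Z. (1 - t) * L z R + t * L z R' \<le> L z S"
    and above: "\<And>z. z \<in> Z \<Longrightarrow> \<exists>R\<in>C. v < L z R"
  shows "\<exists>R\<in>C. \<forall>z\<in>Z. v \<le> L z R"
proof -
  \<comment> \<open>Compactness reduces the claim to finitely many superlevel sets. If these had no
    common point, \<open>finite_minimax\<close> would give an index bounded by \<open>v\<close> on
    all of \<open>C\<close>, against \<open>above\<close>.\<close>
  have "C \<inter> (\<Inter>z\<in>Z. {R. v \<le> L z R}) \<noteq> {}"
  proof (rule compact_imp_fip)
    show "compact C" by fact
    show "closed K" if "K \<in> (\<lambda>z. {R. v \<le> L z R}) ` Z" for K
      using that cont by (auto intro!: closed_Collect_le continuous_on_const)
    fix G assume "finite G" "G \<subseteq> (\<lambda>z. {R. v \<le> L z R}) ` Z"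
    then obtain F where F: "finite F" "F \<subseteq> Z" "G = (\<lambda>z. {R. v \<le> L z R}) ` F"
      using finite_subset_image by metis
    have "\<exists>R\<in>C. \<forall>z\<in>F. v < L z R"
    proof (rule ccontr)
      assume "\<not> ?thesis"
      then have "\<And>R. R \<in> C \<Longrightarrow> \<exists>z\<in>F. L z R \<le> v" by (auto simp: not_less)
      from finite_minimax[OF F(1,2) \<open>Z \<noteq> {}\<close> convex_like concave_like this]
      obtain z where "z \<in> Z" "\<forall>R\<in>C. L z R \<le> v" by blast
      then show False using above[of z] by force
    qed
    then show "C \<inter> \<Inter> G \<noteq> {}" unfolding F(3) by (auto intro: less_imp_le)
  qed
  then show ?thesis by auto
qed

subsection \<open>Duality over the Wasserstein ball\<close>

text \<open>Plans are plain functions, so that the product topology and pointwise convex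
  combinations are available. Only the second marginal is prescribed; the first one is the
  distribution being chosen adversarially.\<close>

definition transport_plans :: "'a set \<Rightarrow> 'a pmf \<Rightarrow> ('a \<times> 'a \<Rightarrow> real) set" where
  "transport_plans S \<mu> = {R. (\<forall>z. 0 \<le> R z) \<and> (\<forall>z. z \<notin> S \<times> S \<longrightarrow> R z = 0) \<and>
     (\<forall>b\<in>S. (\<Sum>a\<in>S. R (a, b)) = pmf \<mu> b)}"

lemma continuous_on_coordinate_sum:
  "continuous_on UNIV (\<lambda>R::'b \<Rightarrow> real. \<Sum>z\<in>A. R (f z) * g z)"
  by (intro continuous_on_sum continuous_on_mult continuous_on_const continuous_on_product_coordinates)

lemma sum_Times_swap: "(\<Sum>z\<in>A \<times> B. f z) = (\<Sum>b\<in>B. \<Sum>a\<in>A. f (a, b))"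
  by (subst sum.swap) (simp add: sum.cartesian_product)

text \<open>Every entry is at most its column sum \<open>pmf \<mu> b\<close>, so the plans form a
  closed subset of a product of unit intervals, which is compact by Tychonoff's theorem.\<close>

lemma compact_transport_plans:
  assumes "finite S"
  shows "compact (transport_plans S \<mu>)"
proof -
  define K where "K = PiE (UNIV :: ('a \<times> 'a) set) (\<lambda>_. {0..1::real})"
  have "compactin (product_topology (\<lambda>_. euclidean) (UNIV :: ('a \<times> 'a) set)) K"
    unfolding K_def compactin_PiE by simp
  then have "compact K" by (simp add: euclidean_product_topology)
  moreover have "closed (transport_plans S \<mu>)"
  proof -
    have "closed {R::'a \<times> 'a \<Rightarrow> real. 0 \<le> R z}" for z
      by (intro closed_Collect_le continuous_on_const continuous_on_product_coordinates)
    moreover have "closed {R::'a \<times> 'a \<Rightarrow> real. z \<notin> S \<times> S \<longrightarrow> R z = 0}" for z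
      by (cases "z \<in> S \<times> S")
        (auto intro!: closed_Collect_eq continuous_on_const continuous_on_product_coordinates)
    moreover have "closed {R::'a \<times> 'a \<Rightarrow> real. b \<in> S \<longrightarrow> (\<Sum>a\<in>S. R (a, b)) = pmf \<mu> b}" for b
      using continuous_on_coordinate_sum[of "\<lambda>a. (a, b)" "\<lambda>_. 1" S]
      by (cases "b \<in> S") (auto intro!: closed_Collect_eq continuous_on_const)
    ultimately show ?thesis
      unfolding transport_plans_def Ball_def
      by (intro closed_Collect_conj closed_Collect_all)
  qed
  moreover have "transport_plans S \<mu> \<subseteq> K"
  proof
    fix R assume R: "R \<in> transport_plans S \<mu>"
    have "R z \<le> 1" for z
    proof (cases "z \<in> S \<times> S")
      case True
      then obtain a b where ab: "z = (a, b)" "a \<in> S" "b \<in> S" by blast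
      have "R (a, b) \<le> (\<Sum>a\<in>S. R (a, b))"
        using R ab assms unfolding transport_plans_def by (intro member_le_sum) auto
      also have "\<dots> = pmf \<mu> b" using R ab unfolding transport_plans_def by blast
      finally show ?thesis using ab pmf_le_1[of \<mu> b] by simp
    next
      case False
      then have "R z = 0" using R unfolding transport_plans_def by blast
      then show ?thesis by simp
    qed
    then show "R \<in> K" using R unfolding K_def transport_plans_def by auto
  qed
  ultimately show ?thesis
    by (metis compact_Int_closed inf.absorb_iff2)
qed

lemma pmf_map_snd_sum:
  assumes "finite S" "set_pmf r \<subseteq> S \<times> S"
  shows "pmf (map_pmf snd r) b = (\<Sum>a\<in>S. pmf r (a, b))"
proof -
  have "pmf (map_pmf snd r) b = measure (measure_pmf r) ((snd -` {b}) \<inter> set_pmf r)"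
    by (simp add: pmf_map measure_Int_set_pmf)
  also have "\<dots> = measure (measure_pmf r) ((S \<times> {b}) \<inter> set_pmf r)"
    using assms(2) by (intro arg_cong2[where f = measure]) auto
  also have "\<dots> = (\<Sum>z\<in>S \<times> {b}. pmf r z)"
    using assms(1) by (simp add: measure_Int_set_pmf measure_measure_pmf_finite)
  also have "\<dots> = (\<Sum>a\<in>S. pmf r (a, b))"
    using sum.cartesian_product[of "\<lambda>a b. pmf r (a, b)" "{b}" S] by simp
  finally show ?thesis .
qed

text \<open>The column sums add up to the total mass of \<open>\<mu>\<close>, which is one; a plan
  is therefore the mass function of a genuine coupling.\<close>

lemma pmf_of_transport_plan:
  assumes "finite S" "set_pmf \<mu> \<subseteq> S" "R \<in> transport_plans S \<mu>"
  obtains r where "\<And>z. pmf r z = R z" "set_pmf r \<subseteq> S \<times> S" "map_pmf snd r = \<mu>"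
proof -
  have R: "\<And>z. 0 \<le> R z" "\<And>z. z \<notin> S \<times> S \<Longrightarrow> R z = 0" "\<And>b. b \<in> S \<Longrightarrow> (\<Sum>a\<in>S. R (a, b)) = pmf \<mu> b"
    using assms(3) unfolding transport_plans_def by blast+
  have "(\<Sum>z\<in>S \<times> S. R z) = (\<Sum>b\<in>S. \<Sum>a\<in>S. R (a, b))"
    by (rule sum_Times_swap)
  also have "\<dots> = 1" using R(3) sum_pmf_eq_1[OF assms(1,2)] by simp
  finally have sum1: "(\<Sum>z\<in>S \<times> S. R z) = 1" .
  have "(\<integral>\<^sup>+z. ennreal (R z) \<partial>count_space UNIV) = (\<Sum>z\<in>S \<times> S. ennreal (R z))"
    using R(2) assms(1) by (intro nn_integral_count_space') auto
  also have "\<dots> = 1" using R(1) sum1 by (simp add: sum_ennreal)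
  finally have 1: "(\<integral>\<^sup>+z. ennreal (R z) \<partial>count_space UNIV) = 1" .
  define r where "r = embed_pmf R"
  have r: "pmf r z = R z" for z
    unfolding r_def by (rule pmf_embed_pmf) (use R(1) 1 in auto)
  have supp: "set_pmf r \<subseteq> S \<times> S"
    using R(2) r by (metis pmf_eq_0_set_pmf subsetI)
  have "map_pmf snd r = \<mu>"
  proof (rule pmf_eqI)
    fix b show "pmf (map_pmf snd r) b = pmf \<mu> b"
    proof (cases "b \<in> S")
      case True then show ?thesis using R(3) by (simp add: pmf_map_snd_sum[OF assms(1) supp] r)
    next
      case False
      then have "pmf \<mu> b = 0" using assms(2) by (metis pmf_eq_0_set_pmf subsetD)
      moreover have "pmf r (a, b) = 0" for a using R(2) False by (simp add: r)
      ultimately show ?thesis by (simp add: pmf_map_snd_sum[OF assms(1) supp])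
    qed
  qed
  then show thesis using that r supp by blast
qed

lemma pmf_in_transport_plans:
  assumes "finite S" "set_pmf r \<subseteq> S \<times> S" "map_pmf snd r = \<mu>"
  shows "pmf r \<in> transport_plans S \<mu>"
  using assms pmf_map_snd_sum[OF assms(1,2)]
  unfolding transport_plans_def by (auto simp: pmf_eq_0_set_pmf)

lemma expectation_fst_sum:
  assumes "finite S" "set_pmf r \<subseteq> S \<times> S"
  shows "measure_pmf.expectation (map_pmf fst r) g = (\<Sum>z\<in>S \<times> S. pmf r z * g (fst z))"
  using integral_measure_pmf_real[of "S \<times> S" r "\<lambda>z. g (fst z)"] assms
  by (auto simp: mult.commute)

text \<open>With the first marginal free, maximizing a linear functional over plans decouples into
  one maximization for each \<open>b\<close>.\<close>

lemma transport_plan_sum_le: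
  assumes S: "finite S" "set_pmf \<mu> \<subseteq> S" and R: "R \<in> transport_plans S \<mu>"
  shows "(\<Sum>z\<in>S \<times> S. R z * g z) \<le> measure_pmf.expectation \<mu> (\<lambda>b. Max ((\<lambda>a. g (a, b)) ` S))"
proof -
  have "(\<Sum>z\<in>S \<times> S. R z * g z) = (\<Sum>b\<in>S. \<Sum>a\<in>S. R (a, b) * g (a, b))"
    by (rule sum_Times_swap)
  also have "\<dots> \<le> (\<Sum>b\<in>S. \<Sum>a\<in>S. R (a, b) * Max ((\<lambda>a. g (a, b)) ` S))"
    using R S(1) unfolding transport_plans_def by (intro sum_mono mult_left_mono) auto
  also have "\<dots> = (\<Sum>b\<in>S. pmf \<mu> b * Max ((\<lambda>a. g (a, b)) ` S))"
    using R unfolding transport_plans_def by (simp flip: sum_distrib_right)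
  also have "\<dots> = measure_pmf.expectation \<mu> (\<lambda>b. Max ((\<lambda>a. g (a, b)) ` S))"
    using S by (subst integral_measure_pmf_real[of S]) (auto simp: mult.commute)
  finally show ?thesis .
qed

text \<open>The decoupled bound is sharp: the plan matches the whole mass at \<open>b\<close> with a
  single maximizer \<open>m b\<close>.\<close>

lemma transport_plan_attaining_max:
  assumes S: "finite S" "set_pmf \<mu> \<subseteq> S"
  shows "\<exists>R\<in>transport_plans S \<mu>.
    (\<Sum>z\<in>S \<times> S. R z * g z) = measure_pmf.expectation \<mu> (\<lambda>b. Max ((\<lambda>a. g (a, b)) ` S))"
proof -
  have "S \<noteq> {}" using S(2) set_pmf_not_empty[of \<mu>] by blast
  have "\<exists>a. a \<in> S \<and> g (a, b) = Max ((\<lambda>a. g (a, b)) ` S)" for b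
  proof -
    have "Max ((\<lambda>a. g (a, b)) ` S) \<in> (\<lambda>a. g (a, b)) ` S"
      using S(1) \<open>S \<noteq> {}\<close> by (intro Max_in) auto
    then obtain a where "Max ((\<lambda>a. g (a, b)) ` S) = g (a, b)" "a \<in> S" by (rule imageE)
    then show ?thesis by (intro exI[of _ a] conjI) simp_all
  qed
  then have "\<exists>m. \<forall>b. m b \<in> S \<and> g (m b, b) = Max ((\<lambda>a. g (a, b)) ` S)"
    by (intro choice allI)
  then obtain m where m: "\<And>b. m b \<in> S" "\<And>b. g (m b, b) = Max ((\<lambda>a. g (a, b)) ` S)"
    by blast
  define R where "R = (\<lambda>(a, b). if b \<in> S \<and> a = m b then pmf \<mu> b else 0)"
  have "R \<in> transport_plans S \<mu>"
    using m(1) S(1) unfolding transport_plans_def R_def by (auto simp: sum.delta)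
  moreover have "(\<Sum>z\<in>S \<times> S. R z * g z) = measure_pmf.expectation \<mu> (\<lambda>b. Max ((\<lambda>a. g (a, b)) ` S))"
  proof -
    have "(\<Sum>z\<in>S \<times> S. R z * g z) = (\<Sum>b\<in>S. \<Sum>a\<in>S. R (a, b) * g (a, b))"
      by (rule sum_Times_swap)
    also have "\<dots> = (\<Sum>b\<in>S. \<Sum>a\<in>S. if a = m b then pmf \<mu> b * g (m b, b) else 0)"
      unfolding R_def by (intro sum.cong) auto
    also have "\<dots> = (\<Sum>b\<in>S. pmf \<mu> b * Max ((\<lambda>a. g (a, b)) ` S))"
      using S(1) m by (simp add: sum.delta)
    also have "\<dots> = measure_pmf.expectation \<mu> (\<lambda>b. Max ((\<lambda>a. g (a, b)) ` S))"
      using S by (subst integral_measure_pmf_real[of S]) (auto simp: mult.commute)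
    finally show ?thesis .
  qed
  ultimately show ?thesis by blast
qed

lemma set_pmf_subset_Times:
  assumes "map_pmf fst r = P" "map_pmf snd r = \<mu>" "set_pmf P \<subseteq> S" "set_pmf \<mu> \<subseteq> S"
  shows "set_pmf r \<subseteq> S \<times> S"
proof
  fix z assume "z \<in> set_pmf r"
  then have "fst z \<in> set_pmf P" "snd z \<in> set_pmf \<mu>" using assms(1,2) by auto
  then show "z \<in> S \<times> S" using assms(3,4) by (auto simp: mem_Times_iff)
qed

text \<open>Weak duality uses an almost optimal coupling for each \<open>P\<close>. Conversely, the
  minimax theorem yields one plan good for all \<open>(\<alpha>, w)\<close> at once: large
  \<open>\<alpha>\<close> forces it to respect the budget, and \<open>\<alpha> = 0\<close> bounds
  its conditional value-at-risk from below.\<close>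

lemma cvar_wasserstein_duality:
  fixes S :: "'a set" and d :: "'a \<Rightarrow> 'a \<Rightarrow> real"
  assumes S: "finite S" "set_pmf \<mu> \<subseteq> S"
    and d: "\<And>a b. 0 \<le> d a b" and p: "0 < p"
  shows "(SUP P\<in>{P. set_pmf P \<subseteq> S \<and> wasserstein S d P \<mu> \<le> \<epsilon>}. cvar P p X) =
    (INF (\<alpha>, w)\<in>{0..} \<times> UNIV. ereal (\<alpha> * \<epsilon> + w + measure_pmf.expectation \<mu>
       (\<lambda>b. Max ((\<lambda>a. 1 / p * max (X a - w) 0 - \<alpha> * d a b) ` S))))"
    (is "(SUP P\<in>?A. cvar P p X) = (INF (\<alpha>, w)\<in>?Z. ereal (?\<phi> \<alpha> w))")
proof (rule antisym)
  define l where "l \<alpha> w z = 1 / p * max (X (fst z) - w) 0 - \<alpha> * d (fst z) (snd z)" for \<alpha> w z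
  \<comment> \<open>The Lagrangian with price \<open>\<alpha>\<close> on the transport budget. The
    variable \<open>w\<close> of the conditional value-at-risk joins \<open>\<alpha>\<close> as a
    minimizer, and maximizing over plans gives \<open>?\<phi> \<alpha> w\<close>.\<close>
  define L where "L = (\<lambda>(\<alpha>, w) R. \<alpha> * \<epsilon> + w + (\<Sum>z\<in>S \<times> S. R z * l \<alpha> w z))"
  define cost where "cost R = (\<Sum>z\<in>S \<times> S. R z * d (fst z) (snd z))" for R
  define ex where "ex w R = (\<Sum>z\<in>S \<times> S. R z * max (X (fst z) - w) 0)" for w R
  have L_eq: "L (\<alpha>, w) R = w + 1 / p * ex w R + \<alpha> * (\<epsilon> - cost R)" for \<alpha> w R
    unfolding L_def l_def ex_def cost_def
    by (simp add: sum_subtractf sum_distrib_left algebra_simps flip: sum_divide_distrib)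
  have \<phi>_eq: "?\<phi> \<alpha> w = \<alpha> * \<epsilon> + w + measure_pmf.expectation \<mu> (\<lambda>b. Max ((\<lambda>a. l \<alpha> w (a, b)) ` S))" for \<alpha> w
    unfolding l_def by simp
  have wass: "wasserstein S d P \<mu> = (INF r\<in>{r. map_pmf fst r = P \<and> map_pmf snd r = \<mu>}. cost (pmf r))" for P
    unfolding wasserstein_def cost_def
    by (simp add: sum.cartesian_product mult.commute case_prod_unfold)
  have bdd: "bdd_below ((\<lambda>r. cost (pmf r)) ` A)" for A
    by (rule bdd_belowI[of _ 0]) (auto simp: cost_def intro!: sum_nonneg mult_nonneg_nonneg d)
  show "(SUP P\<in>?A. cvar P p X) \<le> (INF (\<alpha>, w)\<in>?Z. ereal (?\<phi> \<alpha> w))"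
  proof (intro SUP_least INF_greatest, clarify)
    fix P and \<alpha> w :: real
    assume P: "set_pmf P \<subseteq> S" "wasserstein S d P \<mu> \<le> \<epsilon>" and \<alpha>: "0 \<le> \<alpha>"
    have "w + 1 / p * measure_pmf.expectation P (\<lambda>\<xi>. max (X \<xi> - w) 0) \<le> ?\<phi> \<alpha> w"
    \<comment> \<open>The distance is defined by an infimum, so a coupling is taken whose cost
      exceeds the budget by less than \<open>e / (\<alpha> + 1)\<close>; this denominator also
      covers \<open>\<alpha> = 0\<close>.\<close>
    proof (rule field_le_epsilon)
      fix e :: real assume e: "0 < e"
      have "wasserstein S d P \<mu> < \<epsilon> + e / (\<alpha> + 1)" using P(2) e \<alpha>
        by (smt (verit) divide_pos_pos)
      moreover have "pair_pmf P \<mu> \<in> {r. map_pmf fst r = P \<and> map_pmf snd r = \<mu>}"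
        by (simp add: map_fst_pair_pmf map_snd_pair_pmf)
      ultimately obtain r where r: "map_pmf fst r = P" "map_pmf snd r = \<mu>"
        "cost (pmf r) < \<epsilon> + e / (\<alpha> + 1)"
        unfolding wass using bdd by (subst (asm) cINF_less_iff) auto
      have rS: "set_pmf r \<subseteq> S \<times> S" using set_pmf_subset_Times r(1,2) P(1) S(2) by blast
      have "measure_pmf.expectation P (\<lambda>\<xi>. max (X \<xi> - w) 0) = ex w (pmf r)"
        unfolding ex_def r(1)[symmetric] by (rule expectation_fst_sum[OF S(1) rS])
      then have "w + 1 / p * measure_pmf.expectation P (\<lambda>\<xi>. max (X \<xi> - w) 0) =
          L (\<alpha>, w) (pmf r) + \<alpha> * (cost (pmf r) - \<epsilon>)"
        unfolding L_eq by (simp add: algebra_simps)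
      also have "L (\<alpha>, w) (pmf r) \<le> ?\<phi> \<alpha> w"
        using transport_plan_sum_le[OF S pmf_in_transport_plans[OF S(1) rS r(2)], of "l \<alpha> w"]
        unfolding \<phi>_eq L_def by simp
      also have "\<alpha> * (cost (pmf r) - \<epsilon>) \<le> \<alpha> * (e / (\<alpha> + 1))"
        using r(3) \<alpha> by (intro mult_left_mono) auto
      also have "\<dots> \<le> e" using \<alpha> e by (simp add: field_simps)
      finally show "w + 1 / p * measure_pmf.expectation P (\<lambda>\<xi>. max (X \<xi> - w) 0) \<le> ?\<phi> \<alpha> w + e"
        by simp
    qed
    then show "cvar P p X \<le> ereal (?\<phi> \<alpha> w)"
      unfolding cvar_def by (intro INF_lower2[of w]) auto
  qed
  show "(INF (\<alpha>, w)\<in>?Z. ereal (?\<phi> \<alpha> w)) \<le> (SUP P\<in>?A. cvar P p X)"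
  \<comment> \<open>Working with levels \<open>u\<close> strictly below the infimum supplies the
    strict inequality that \<open>minimax\<close> asks for.\<close>
  proof (rule dense_le)
    fix u assume u: "u < (INF (\<alpha>, w)\<in>?Z. ereal (?\<phi> \<alpha> w))"
    show "u \<le> (SUP P\<in>?A. cvar P p X)"
    proof (cases u)
      case PInf
      then show ?thesis using u by simp
    next
      case MInf
      then show ?thesis by simp
    next
      case (real v)
      have v: "v < ?\<phi> \<alpha> w" if "0 \<le> \<alpha>" for \<alpha> w
      proof -
        have "(INF (\<alpha>, w)\<in>?Z. ereal (?\<phi> \<alpha> w)) \<le> ereal (?\<phi> \<alpha> w)"
          by (rule INF_lower2[of "(\<alpha>, w)"]) (use that in auto)
        with u have "u < ereal (?\<phi> \<alpha> w)" by (rule order_less_le_trans)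
        then show ?thesis using real by simp
      qed
      have "\<exists>R\<in>transport_plans S \<mu>. \<forall>z\<in>?Z. v \<le> L z R"
      proof (rule minimax)
        show "compact (transport_plans S \<mu>)" by (rule compact_transport_plans[OF S(1)])
        show "?Z \<noteq> {}" by auto
        show "continuous_on UNIV (L z)" if "z \<in> ?Z" for z
          unfolding L_def case_prod_unfold
          by (intro continuous_on_add continuous_on_const continuous_on_coordinate_sum)
        \<comment> \<open>The price \<open>\<alpha>\<close> enters affinely, and \<open>w\<close>
          through a convex positive part weighted by the nonnegative masses \<open>R z\<close>; the
          convex combination of the two points is thus a witness.\<close>
        show "\<exists>y\<in>?Z. \<forall>R\<in>transport_plans S \<mu>. L y R \<le> (1 - t) * L z R + t * L z' R"
          if zz: "z \<in> ?Z" "z' \<in> ?Z" and t: "0 \<le> t" "t \<le> 1" for z z' t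
        proof -
          obtain \<alpha> w \<alpha>' w' where z: "z = (\<alpha>, w)" "z' = (\<alpha>', w')" "0 \<le> \<alpha>" "0 \<le> \<alpha>'"
            using zz by auto
          let ?\<alpha> = "(1 - t) * \<alpha> + t * \<alpha>'" and ?w = "(1 - t) * w + t * w'"
          have "L (?\<alpha>, ?w) R \<le> (1 - t) * L z R + t * L z' R" if R: "R \<in> transport_plans S \<mu>" for R
          proof -
            have "max (x - ?w) 0 \<le> (1 - t) * max (x - w) 0 + t * max (x - w') 0" for x
            proof -
              have "x - ?w = (1 - t) * (x - w) + t * (x - w')" by (simp add: algebra_simps)
              moreover have "\<dots> \<le> (1 - t) * max (x - w) 0 + t * max (x - w') 0"
                using t by (intro add_mono mult_left_mono) auto
              moreover have "0 \<le> (1 - t) * max (x - w) 0 + t * max (x - w') 0" using t by simp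
              ultimately show ?thesis by simp
            qed
            then have "ex ?w R \<le> (\<Sum>z\<in>S \<times> S. R z * ((1 - t) * max (X (fst z) - w) 0 + t * max (X (fst z) - w') 0))"
              using R unfolding ex_def transport_plans_def by (intro sum_mono mult_left_mono) auto
            also have "\<dots> = (1 - t) * ex w R + t * ex w' R"
              unfolding ex_def by (simp add: sum_distrib_left algebra_simps flip: sum.distrib)
            finally have "1 / p * ex ?w R \<le> 1 / p * ((1 - t) * ex w R + t * ex w' R)"
              using p by (intro mult_left_mono) auto
            then have "1 / p * ex ?w R \<le> (1 - t) * (1 / p * ex w R) + t * (1 / p * ex w' R)"
              by (simp only: distrib_left mult.left_commute)
            then show ?thesis unfolding z(1,2) L_eq by (simp only: ring_distribs)
          qed
          moreover have "(?\<alpha>, ?w) \<in> ?Z" using z t by simp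
          ultimately show ?thesis by blast
        qed
        show "\<exists>R''\<in>transport_plans S \<mu>. \<forall>z\<in>?Z. (1 - t) * L z R + t * L z R' \<le> L z R''"
          if R: "R \<in> transport_plans S \<mu>" "R' \<in> transport_plans S \<mu>" and t: "0 \<le> t" "t \<le> 1" for R R' t
        proof -
          let ?R = "\<lambda>z. (1 - t) * R z + t * R' z"
          have "(\<Sum>a\<in>S. ?R (a, b)) = pmf \<mu> b" if "b \<in> S" for b
          proof -
            have "(\<Sum>a\<in>S. ?R (a, b)) = (1 - t) * (\<Sum>a\<in>S. R (a, b)) + t * (\<Sum>a\<in>S. R' (a, b))"
              by (simp add: sum.distrib sum_distrib_left)
            also have "\<dots> = (1 - t) * pmf \<mu> b + t * pmf \<mu> b"
              using R that unfolding transport_plans_def by auto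
            finally show ?thesis by (simp add: algebra_simps)
          qed
          then have mem: "?R \<in> transport_plans S \<mu>"
            using R t unfolding transport_plans_def by auto
          have "L z ?R = (1 - t) * L z R + t * L z R'" for z
            unfolding L_def case_prod_unfold
            by (simp add: sum.distrib sum_distrib_left algebra_simps sum_subtractf)
          then show ?thesis by (intro bexI[OF _ mem] ballI eq_refl) (rule sym)
        qed
        show "\<exists>R\<in>transport_plans S \<mu>. v < L z R" if zZ: "z \<in> ?Z" for z
        proof -
          obtain \<alpha> w where z: "z = (\<alpha>, w)" "0 \<le> \<alpha>" using zZ by auto
          obtain R where "R \<in> transport_plans S \<mu>"
            "(\<Sum>z\<in>S \<times> S. R z * l \<alpha> w z) = measure_pmf.expectation \<mu> (\<lambda>b. Max ((\<lambda>a. l \<alpha> w (a, b)) ` S))"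
            using transport_plan_attaining_max[OF S] by blast
          then show ?thesis using v[OF z(2), of w] unfolding \<phi>_eq z(1) L_def
            by (intro bexI[of _ R]) simp_all
        qed
      qed
      then obtain R where R: "R \<in> transport_plans S \<mu>" "\<And>\<alpha> w. 0 \<le> \<alpha> \<Longrightarrow> v \<le> L (\<alpha>, w) R"
        by auto
      obtain r where r: "\<And>z. pmf r z = R z" "set_pmf r \<subseteq> S \<times> S" "map_pmf snd r = \<mu>"
        using pmf_of_transport_plan[OF S R(1)] by blast
      have "pmf r = R" using r(1) by blast
      \<comment> \<open>Otherwise \<open>L (\<alpha>, 0) R\<close> would fall below \<open>v\<close>
        for large \<open>\<alpha>\<close>.\<close>
      have "cost R \<le> \<epsilon>"
      proof (rule ccontr)
        assume "\<not> cost R \<le> \<epsilon>"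
        then have "0 < cost R - \<epsilon>" by simp
        then obtain k :: nat where "1 / p * ex 0 R - v < real k * (cost R - \<epsilon>)"
          using ex_less_of_nat_mult by blast
        then show False using R(2)[of "real k" 0] unfolding L_eq by (simp add: algebra_simps)
      qed
      define P where "P = map_pmf fst r"
      have "wasserstein S d P \<mu> \<le> cost (pmf r)"
        unfolding wass by (rule cINF_lower[OF bdd]) (use r(3) P_def in auto)
      also have "\<dots> \<le> \<epsilon>" using \<open>cost R \<le> \<epsilon>\<close> \<open>pmf r = R\<close> by simp
      finally have "P \<in> ?A" using r(2) unfolding P_def by auto
      \<comment> \<open>At \<open>\<alpha> = 0\<close> the Lagrangian is exactly the objective of
        the conditional value-at-risk under \<open>P\<close>.\<close>
      moreover have "u \<le> cvar P p X"
        unfolding cvar_def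
      proof (rule INF_greatest)
        fix w
        have "measure_pmf.expectation P (\<lambda>\<xi>. max (X \<xi> - w) 0) = ex w R"
          unfolding ex_def P_def \<open>pmf r = R\<close>[symmetric] by (rule expectation_fst_sum[OF S(1) r(2)])
        then show "u \<le> ereal (w + 1 / p * measure_pmf.expectation P (\<lambda>\<xi>. max (X \<xi> - w) 0))"
          using R(2)[of 0 w] real unfolding L_eq by simp
      qed
      ultimately show ?thesis by (rule SUP_upper2)
    qed
  qed
qed

subsection \<open>Conic duality for the second stage\<close>

text \<open>The achievable pairs of slack and cost are separated from the pairs with nonnegative
  slack and cost below \<open>V\<close>. The Slater point excludes a vertical hyperplane, and
  dividing the normal by its negated cost entry gives the multiplier.\<close>

lemma conic_strong_duality:
  fixes Y :: "(real^'n) set" and A :: "real^'n^'l" and b :: "real^'l"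
  assumes Y: "cone Y" "convex Y" "0 \<in> Y"
    and slater: "y0 \<in> Y" "\<And>l. 0 < (A *v y0) $ l"
    and bound: "\<And>y. y \<in> Y \<Longrightarrow> \<forall>l. b $ l \<le> (A *v y) $ l \<Longrightarrow> V \<le> q \<bullet> y"
  shows "\<exists>lam. (\<forall>l. 0 \<le> lam $ l) \<and> (\<forall>y\<in>Y. lam \<bullet> (A *v y) \<le> q \<bullet> y) \<and> V \<le> lam \<bullet> b"
proof -
  have scale: "t *\<^sub>R y \<in> Y" if "y \<in> Y" "0 \<le> t" for t y
    using Y(1) that unfolding cone_def by blast
  define C where "C = {(u, r). \<exists>y\<in>Y. (\<forall>l. u $ l \<le> (A *v y - b) $ l) \<and> q \<bullet> y \<le> r}"
  define D where "D = {(u::real^'l, r). (\<forall>l. 0 \<le> u $ l) \<and> r < V}"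
  have "convex C"
    unfolding convex_def
  proof clarify
    fix u r u' r' and s t :: real
    assume "(u, r) \<in> C" "(u', r') \<in> C" and st: "0 \<le> s" "0 \<le> t" "s + t = 1"
    then obtain y y' where y: "y \<in> Y" "\<forall>l. u $ l \<le> (A *v y - b) $ l" "q \<bullet> y \<le> r"
      and y': "y' \<in> Y" "\<forall>l. u' $ l \<le> (A *v y' - b) $ l" "q \<bullet> y' \<le> r'"
      unfolding C_def by blast
    let ?y = "s *\<^sub>R y + t *\<^sub>R y'"
    have "?y \<in> Y" using Y(2) y(1) y'(1) st unfolding convex_def by blast
    moreover have "A *v ?y - b = s *\<^sub>R (A *v y - b) + t *\<^sub>R (A *v y' - b)"
    proof -
      have "s *\<^sub>R b + t *\<^sub>R b = b" using st(3) by (metis scaleR_left_distrib scaleR_one)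
      moreover have "s *\<^sub>R (A *v y - b) + t *\<^sub>R (A *v y' - b) = A *v ?y - (s *\<^sub>R b + t *\<^sub>R b)"
        by (simp add: matrix_vector_right_distrib matrix_vector_mult_scaleR scaleR_diff_right)
      ultimately show ?thesis by simp
    qed
    then have "(s *\<^sub>R u + t *\<^sub>R u') $ l \<le> (A *v ?y - b) $ l" for l
      using add_mono[OF mult_left_mono[OF spec[OF y(2), of l] st(1)]
          mult_left_mono[OF spec[OF y'(2), of l] st(2)]] by simp
    moreover have "q \<bullet> ?y \<le> s * r + t * r'"
      using add_mono[OF mult_left_mono[OF y(3) st(1)] mult_left_mono[OF y'(3) st(2)]]
      by (simp add: inner_add_right)
    ultimately show "s *\<^sub>R (u, r) + t *\<^sub>R (u', r') \<in> C"
      unfolding C_def by auto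
  qed
  moreover have "convex D"
    unfolding convex_def D_def
    by (auto intro!: add_nonneg_nonneg mult_nonneg_nonneg convex_bound_lt)
  moreover have "(A *v 0 - b, q \<bullet> 0) \<in> C" using Y(3) unfolding C_def by blast
  then have "C \<noteq> {}" by blast
  moreover have "(0, V - 1) \<in> D" unfolding D_def by simp
  then have "D \<noteq> {}" by blast
  moreover have "C \<inter> D = {}"
  proof (rule ccontr)
    assume "C \<inter> D \<noteq> {}"
    then obtain u r y where "\<forall>l. 0 \<le> u $ l" "r < V" "y \<in> Y" "\<forall>l. u $ l \<le> (A *v y - b) $ l" "q \<bullet> y \<le> r"
      unfolding C_def D_def by auto
    moreover from this have "\<forall>l. b $ l \<le> (A *v y) $ l"
      by (metis (no_types, lifting) diff_ge_0_iff_ge order_trans vector_minus_component)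
    then have "V \<le> q \<bullet> y" using bound[OF \<open>y \<in> Y\<close>] by blast
    ultimately show False by linarith
  qed
  ultimately obtain n \<beta> where n: "n \<noteq> 0" "\<forall>z\<in>C. n \<bullet> z \<le> \<beta>" "\<forall>z\<in>D. \<beta> \<le> n \<bullet> z"
    using separating_hyperplane_sets by metis
  obtain m s where ms: "n = (m, s)" by (cases n)
  have le: "m \<bullet> u + s * r \<le> \<beta>" if "y \<in> Y" "\<And>l. u $ l \<le> (A *v y - b) $ l" "q \<bullet> y \<le> r" for u y r
    using n(2) that unfolding ms C_def by auto
  have ge: "\<beta> \<le> m \<bullet> u + s * r" if "\<And>l. 0 \<le> u $ l" "r < V" for u r
    using n(3) that unfolding ms D_def by auto
  have m: "0 \<le> m $ l" for l
  proof (rule ccontr)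
    assume "\<not> 0 \<le> m $ l"
    then have "0 < - m $ l" by simp
    obtain k :: nat where "s * (V - 1) - \<beta> < real k * (- m $ l)"
      using ex_less_of_nat_mult[OF \<open>0 < - m $ l\<close>] by blast
    moreover have "\<beta> \<le> m \<bullet> (real k *\<^sub>R axis l 1) + s * (V - 1)"
      by (rule ge) (simp_all add: axis_def)
    ultimately show False by (simp add: inner_axis)
  qed
  have s: "s \<le> 0"
  proof (rule ccontr)
    assume "\<not> s \<le> 0"
    then have "0 < s" by simp
    obtain k :: nat where "s * V - \<beta> < real k * s"
      using ex_less_of_nat_mult[OF \<open>0 < s\<close>] by blast
    then show False
      using ge[of 0 "V - real k - 1"] \<open>0 < s\<close> by (simp add: algebra_simps)
  qed
  \<comment> \<open>Costs in \<open>D\<close> only approach \<open>V\<close> from below. Since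
    \<open>s \<le> 0\<close>, the denominator \<open>1 - s\<close> is positive and the error
    \<open>- s * e / (1 - s)\<close> stays below \<open>e\<close>.\<close>
  have \<beta>: "\<beta> \<le> s * V"
  proof (rule field_le_epsilon)
    fix e :: real assume "0 < e"
    have "\<beta> \<le> s * (V - e / (1 - s))"
      using ge[of 0 "V - e / (1 - s)"] \<open>0 < e\<close> s by simp
    also have "\<dots> \<le> s * V + e"
      using \<open>0 < e\<close> s by (simp add: field_simps)
    finally show "\<beta> \<le> s * V + e" .
  qed
  have main: "m \<bullet> (A *v y - b) + s * (q \<bullet> y) \<le> s * V" if "y \<in> Y" for y
    using le[OF that order_refl order_refl] \<beta> by linarith
  \<comment> \<open>If \<open>s\<close> vanished, large multiples of \<open>y0\<close> would force
    \<open>m \<bullet> (A *v y0) \<le> 0\<close>. All its terms are nonnegative and the entries of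
    \<open>A *v y0\<close> are positive, so \<open>m = 0\<close>, contradicting the nonzero
    normal.\<close>
  have "s \<noteq> 0"
  proof
    assume "s = 0"
    have "m \<bullet> (A *v y0) \<le> 0"
    proof (rule ccontr)
      assume "\<not> ?thesis"
      then have pos: "0 < m \<bullet> (A *v y0)" by simp
      obtain k :: nat where "m \<bullet> b < real k * (m \<bullet> (A *v y0))"
        using ex_less_of_nat_mult[OF pos] by blast
      then show False
        using main[OF scale[OF slater(1), of "real k"]] \<open>s = 0\<close>
        by (simp add: matrix_vector_mult_scaleR inner_diff_right)
    qed
    moreover have nonneg: "0 \<le> m $ l * (A *v y0) $ l" for l
      using m slater(2) by (simp add: less_imp_le)
    ultimately have "(\<Sum>l\<in>UNIV. m $ l * (A *v y0) $ l) = 0"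
      unfolding inner_vec_def inner_real_def by (intro order_antisym sum_nonneg)
    then have "\<forall>l\<in>UNIV. m $ l * (A *v y0) $ l = 0"
      by (subst (asm) sum_nonneg_eq_0_iff) (use nonneg in auto)
    then have "m $ l = 0" for l
      using slater(2)[of l] by (metis UNIV_I less_irrefl mult_eq_0_iff)
    then have "m = 0" by (simp add: vec_eq_iff)
    then show False using n(1) ms \<open>s = 0\<close> by (simp add: zero_prod_def)
  qed
  with s have "s < 0" by simp
  define lam where "lam = (1 / - s) *\<^sub>R m"
  have key: "lam \<bullet> (A *v y) - lam \<bullet> b - q \<bullet> y \<le> - V" if "y \<in> Y" for y
  proof -
    have m_eq: "m = (- s) *\<^sub>R lam" unfolding lam_def using \<open>s < 0\<close> by simp
    have "(- s) * (lam \<bullet> (A *v y) - lam \<bullet> b - q \<bullet> y) \<le> (- s) * (- V)"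
      using main[OF that] unfolding m_eq by (simp add: inner_diff_right algebra_simps)
    then show ?thesis by (rule mult_left_le_imp_le) (use \<open>s < 0\<close> in simp)
  qed
  \<comment> \<open>The bound \<open>key\<close> holds along the whole ray through \<open>y\<close>,
    so its homogeneous part cannot be positive. The remaining constant part comes from
    \<open>y = 0\<close>.\<close>
  have "lam \<bullet> (A *v y) \<le> q \<bullet> y" if "y \<in> Y" for y
  proof (rule ccontr)
    assume "\<not> ?thesis"
    then have pos: "0 < lam \<bullet> (A *v y) - q \<bullet> y" by simp
    obtain k :: nat where "lam \<bullet> b - V < real k * (lam \<bullet> (A *v y) - q \<bullet> y)"
      using ex_less_of_nat_mult[OF pos] by blast
    then show False
      using key[OF scale[OF that, of "real k"]]
      by (simp add: matrix_vector_mult_scaleR algebra_simps)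
  qed
  moreover have "V \<le> lam \<bullet> b" using key[OF Y(3)] by simp
  moreover have "0 \<le> lam $ l" for l
    using m[of l] \<open>s < 0\<close> unfolding lam_def by (simp add: divide_nonneg_neg)
  ultimately show ?thesis by blast
qed

section \<open>Closed convex hulls and the homogenized dual of the second stage\<close>

lemma finite_binary_vectors: "finite (binary_vectors :: (real^'m) set)"
proof (rule inj_on_finite)
  show "inj_on (\<lambda>\<xi>. {j. \<xi> $ j = 1}) (binary_vectors :: (real^'m) set)"
  proof (rule inj_onI)
    fix \<xi> \<zeta> :: "real^'m"
    assume *: "\<xi> \<in> binary_vectors" "\<zeta> \<in> binary_vectors" "{j. \<xi> $ j = 1} = {j. \<zeta> $ j = 1}"
    have "\<xi> $ j = \<zeta> $ j" for j
    proof -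
      have "\<xi> $ j = 1 \<longleftrightarrow> \<zeta> $ j = 1" using *(3) by blast
      moreover have "\<xi> $ j \<in> {0, 1}" "\<zeta> $ j \<in> {0, 1}"
        using *(1,2) unfolding binary_vectors_def by blast+
      ultimately show ?thesis by auto
    qed
    then show "\<xi> = \<zeta>" by (simp add: vec_eq_iff)
  qed
qed auto

text \<open>A real upper bound on \<open>S\<close> places \<open>S\<close> in a closed half-space,
  which then contains the closed convex hull. Comparing real upper bounds also handles infinite
  suprema.\<close>

lemma SUP_inner_closure_convex_hull:
  fixes S :: "'a::real_inner set"
  shows "(SUP z\<in>closure (convex hull S). ereal (a \<bullet> z)) = (SUP z\<in>S. ereal (a \<bullet> z))"
proof (rule antisym)
  show "(SUP z\<in>S. ereal (a \<bullet> z)) \<le> (SUP z\<in>closure (convex hull S). ereal (a \<bullet> z))"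
    by (intro SUP_subset_mono order_refl order_trans[OF hull_subset closure_subset])
  show "(SUP z\<in>closure (convex hull S). ereal (a \<bullet> z)) \<le> (SUP z\<in>S. ereal (a \<bullet> z))"
  proof (rule ereal_le_real)
    fix m assume "(SUP z\<in>S. ereal (a \<bullet> z)) \<le> ereal m"
    then have "S \<subseteq> {z. a \<bullet> z \<le> m}" by (auto simp: SUP_le_iff)
    then have "closure (convex hull S) \<subseteq> {z. a \<bullet> z \<le> m}"
      by (intro closure_minimal hull_minimal convex_halfspace_le closed_halfspace_le)
    then show "(SUP z\<in>closure (convex hull S). ereal (a \<bullet> z)) \<le> ereal m"
      by (auto simp: SUP_le_iff)
  qed
qed

lemma sum_matrix_vector_mult:
  fixes f :: "'j \<Rightarrow> real^'n^'l"
  shows "(\<Sum>j\<in>J. f j) *v y = (\<Sum>j\<in>J. f j *v y)"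
  by (induction J rule: infinite_finite_induct) (simp_all add: matrix_vector_mult_add_rdistrib)

lemma W_of_mult_vector: "W_of W0 W \<xi> *v y = W0 *v y + (\<Sum>j\<in>UNIV. \<xi> $ j *\<^sub>R (W j *v y))"
  unfolding W_of_def
  by (simp add: matrix_vector_mult_add_rdistrib sum_matrix_vector_mult scaleR_matrix_vector_assoc)

lemma inner_outer_product:
  fixes B :: "real^'m^'l"
  shows "B \<bullet> (\<chi> l j. lam $ l * \<xi> $ j) = lam \<bullet> (B *v \<xi>)"
  by (simp add: inner_vec_def matrix_vector_mult_def sum_distrib_left mult_ac)

lemma transpose_inner:
  fixes A :: "real^'n^'l"
  shows "(transpose A *v lam) \<bullet> y = lam \<bullet> (A *v y)"
  by (simp add: dot_lmul_matrix)

text \<open>Column \<open>j\<close> of the outer product is \<open>\<xi> $ j *\<^sub>R lam\<close>,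
  so the separate terms in \<open>W j\<close> recombine into the recourse matrix at
  \<open>\<xi>\<close>.\<close>

lemma dual_slack_inner:
  fixes W :: "'m::finite \<Rightarrow> real^'n^'l"
  shows "(\<theta> *\<^sub>R (q0 + Q *v \<xi>) - transpose W0 *v lam
      - (\<Sum>j\<in>UNIV. transpose (W j) *v ((\<chi> l j. lam $ l * \<xi> $ j) *v axis j 1))) \<bullet> y =
    \<theta> * (q_of q0 Q \<xi> \<bullet> y) - lam \<bullet> (W_of W0 W \<xi> *v y)"
proof -
  have "(\<chi> l j. lam $ l * \<xi> $ j) *v axis j 1 = \<xi> $ j *\<^sub>R lam" for j
    by (simp add: vec_eq_iff matrix_vector_mult_basis column_def)
  then have "(transpose (W j) *v ((\<chi> l j. lam $ l * \<xi> $ j) *v axis j 1)) \<bullet> y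
      = lam \<bullet> (\<xi> $ j *\<^sub>R (W j *v y))" for j
    by (simp only: transpose_inner inner_scaleR_left inner_scaleR_right)
  then show ?thesis
    by (simp only: inner_diff_left inner_sum_left inner_scaleR_left transpose_inner W_of_mult_vector
        inner_add_right inner_sum_right q_of_def)
qed

text \<open>Membership in the dual cone is unfolded into inequalities against every
  \<open>y\<close>, the form in which conic duality delivers and consumes multipliers.\<close>

lemma mem_Z_set_iff:
  "(\<xi>, lam, Lam, \<tau>, \<theta>) \<in> Z_set nrm \<Xi> \<xi>0 p Y q0 Q W0 W \<longleftrightarrow>
    \<xi> \<in> \<Xi> \<and> (\<forall>l. 0 \<le> lam $ l) \<and> 0 \<le> \<tau> \<and> \<theta> \<in> {0..1 / p} \<and>
    Lam = (\<chi> l j. lam $ l * \<xi> $ j) \<and> nrm (\<xi> - \<xi>0) \<le> \<tau> \<and>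
    (\<forall>y\<in>Y. lam \<bullet> (W_of W0 W \<xi> *v y) \<le> \<theta> * (q_of q0 Q \<xi> \<bullet> y))"
proof -
  have slack: "(\<theta> *\<^sub>R (q0 + Q *v \<xi>) - transpose W0 *v lam
          - (\<Sum>j\<in>UNIV. transpose (W j) *v ((\<chi> l j. lam $ l * \<xi> $ j) *v axis j 1)) \<in> dual_cone Y) \<longleftrightarrow>
      (\<forall>y\<in>Y. lam \<bullet> (W_of W0 W \<xi> *v y) \<le> \<theta> * (q_of q0 Q \<xi> \<bullet> y))"
    unfolding dual_cone_def mem_Collect_eq dual_slack_inner by simp
  show ?thesis
  proof (cases "Lam = (\<chi> l j. lam $ l * \<xi> $ j)")
    case True
    show ?thesis
      unfolding True Z_set_def norm_cone_def mem_Collect_eq prod.case slack by (rule refl)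
  next
    case False
    then show ?thesis unfolding Z_set_def mem_Collect_eq prod.case by blast
  qed
qed

text \<open>For positive \<open>\<theta>\<close> the dual bound is divided by
  \<open>\<theta>\<close> before passing to the infimum. For \<open>\<theta> = 0\<close> it says
  that \<open>lam\<close> has nonpositive value, which is read off at a single feasible
  \<open>y\<close>.\<close>

lemma second_stage_weak_duality:
  assumes fin: "\<bar>second_stage Y q0 Q W0 W T h x \<xi>\<bar> \<noteq> \<infinity>"
    and lam: "\<And>l. 0 \<le> lam $ l" and \<theta>: "0 \<le> \<theta>"
    and dual: "\<And>y. y \<in> Y \<Longrightarrow> lam \<bullet> (W_of W0 W \<xi> *v y) \<le> \<theta> * (q_of q0 Q \<xi> \<bullet> y)"
  shows "lam \<bullet> (T x *v \<xi> + h x) \<le> \<theta> * real_of_ereal (second_stage Y q0 Q W0 W T h x \<xi>)"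
proof -
  let ?F = "{y\<in>Y. \<forall>l. (T x *v \<xi> + h x) $ l \<le> (W_of W0 W \<xi> *v y) $ l}"
  obtain V where V: "second_stage Y q0 Q W0 W T h x \<xi> = ereal V"
    using fin by (cases "second_stage Y q0 Q W0 W T h x \<xi>") auto
  have weak: "lam \<bullet> (T x *v \<xi> + h x) \<le> \<theta> * (q_of q0 Q \<xi> \<bullet> y)" if "y \<in> ?F" for y
  proof -
    have "lam \<bullet> (T x *v \<xi> + h x) \<le> lam \<bullet> (W_of W0 W \<xi> *v y)"
      using that lam unfolding inner_vec_def inner_real_def by (intro sum_mono mult_left_mono) auto
    also have "\<dots> \<le> \<theta> * (q_of q0 Q \<xi> \<bullet> y)" using dual that by blast
    finally show ?thesis .
  qed
  \<comment> \<open>The infimum over the empty set is \<open>\<infinity>\<close>, so finiteness of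
    the value implies feasibility.\<close>
  have "?F \<noteq> {}"
  proof
    assume "?F = {}"
    then have "second_stage Y q0 Q W0 W T h x \<xi> = \<infinity>"
      unfolding second_stage_def by (simp only: image_empty Inf_empty top_ereal_def)
    then show False using V by simp
  qed
  show ?thesis
  proof (cases "\<theta> = 0")
    case True
    then show ?thesis using weak \<open>?F \<noteq> {}\<close> by auto
  next
    case False
    then have "0 < \<theta>" using \<theta> by simp
    have "ereal (lam \<bullet> (T x *v \<xi> + h x) / \<theta>) \<le> second_stage Y q0 Q W0 W T h x \<xi>"
      unfolding second_stage_def
    proof (rule INF_greatest)
      fix y assume "y \<in> ?F"
      then show "ereal (lam \<bullet> (T x *v \<xi> + h x) / \<theta>) \<le> ereal (q_of q0 Q \<xi> \<bullet> y)"
        using weak \<open>0 < \<theta>\<close> by (simp add: pos_divide_le_eq mult.commute)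
    qed
    then show ?thesis using V \<open>0 < \<theta>\<close> by (simp add: pos_divide_le_eq mult.commute)
  qed
qed

text \<open>The finite optimal value is a real lower bound on all feasible costs, as conic duality
  requires. The multiplier belongs to \<open>\<theta> = 1\<close> and is rescaled when used.\<close>

lemma second_stage_strong_duality:
  assumes Y: "proper_cone Y"
    and slater: "\<exists>y\<in>interior Y. \<forall>l. 0 < (W_of W0 W \<xi> *v y) $ l"
    and fin: "\<bar>second_stage Y q0 Q W0 W T h x \<xi>\<bar> \<noteq> \<infinity>"
  shows "\<exists>lam. (\<forall>l. 0 \<le> lam $ l) \<and>
    (\<forall>y\<in>Y. lam \<bullet> (W_of W0 W \<xi> *v y) \<le> q_of q0 Q \<xi> \<bullet> y) \<and>
    real_of_ereal (second_stage Y q0 Q W0 W T h x \<xi>) \<le> lam \<bullet> (T x *v \<xi> + h x)"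
proof -
  obtain y0 where y0: "y0 \<in> Y" "\<And>l. 0 < (W_of W0 W \<xi> *v y0) $ l"
    using slater interior_subset by blast
  show ?thesis
  proof (rule conic_strong_duality[OF _ _ _ y0])
    show "cone Y" "convex Y" "0 \<in> Y" using Y unfolding proper_cone_def by auto
    fix y assume "y \<in> Y" "\<forall>l. (T x *v \<xi> + h x) $ l \<le> (W_of W0 W \<xi> *v y) $ l"
    then have "second_stage Y q0 Q W0 W T h x \<xi> \<le> ereal (q_of q0 Q \<xi> \<bullet> y)"
      unfolding second_stage_def by (intro INF_lower) simp
    then show "real_of_ereal (second_stage Y q0 Q W0 W T h x \<xi>) \<le> q_of q0 Q \<xi> \<bullet> y"
      using fin by (cases "second_stage Y q0 Q W0 W T h x \<xi>") auto
  qed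
qed

text \<open>Once the hull is removed, each \<open>\<xi>\<close> can be treated alone: the best
  \<open>\<tau>\<close> is the norm itself, the best multiplier contributes
  \<open>\<theta> * V \<xi>\<close>, and the rest is linear in \<open>\<theta>\<close>.\<close>

lemma Z_fun_eq_Max:
  fixes \<Xi> :: "(real^'m) set"
  assumes \<Xi>: "finite \<Xi>" "\<Xi> \<noteq> {}"
    and nrm: "\<And>v. 0 \<le> nrm v" and p: "0 < p" and \<alpha>: "0 \<le> \<alpha>"
    and Y: "proper_cone Y"
    and slater: "\<And>\<xi>. \<xi> \<in> \<Xi> \<Longrightarrow> \<exists>y\<in>interior Y. \<forall>l. 0 < (W_of W0 W \<xi> *v y) $ l"
    and fin: "\<And>\<xi>. \<xi> \<in> \<Xi> \<Longrightarrow> \<bar>second_stage Y q0 Q W0 W T h x \<xi>\<bar> \<noteq> \<infinity>"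
  shows "Z_fun nrm \<Xi> \<xi>0 p Y q0 Q W0 W T h x \<alpha> w =
    ereal (Max ((\<lambda>\<xi>. 1 / p * max (real_of_ereal (second_stage Y q0 Q W0 W T h x \<xi>) - w) 0
      - \<alpha> * nrm (\<xi> - \<xi>0)) ` \<Xi>))"
proof -
  define V where "V \<xi> = real_of_ereal (second_stage Y q0 Q W0 W T h x \<xi>)" for \<xi>
  define g where "g \<xi> = 1 / p * max (V \<xi> - w) 0 - \<alpha> * nrm (\<xi> - \<xi>0)" for \<xi>
  let ?Z = "Z_set nrm \<Xi> \<xi>0 p Y q0 Q W0 W"
  \<comment> \<open>The objective as an inner product on the product space, so that the hull lemma
    applies; \<open>\<xi>\<close> has coefficient zero, as it acts only through
    \<open>Lam\<close>.\<close>
  define a where "a = (0 :: real^'m, h x, T x, - \<alpha>, - w)"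
  have a: "a \<bullet> (\<xi>, lam, Lam, \<tau>, \<theta>) = T x \<bullet> Lam + h x \<bullet> lam - w * \<theta> - \<alpha> * \<tau>" for \<xi> lam Lam \<tau> \<theta>
    unfolding a_def by simp
  have val: "a \<bullet> (\<xi>, lam, \<chi> l j. lam $ l * \<xi> $ j, \<tau>, \<theta>) =
      lam \<bullet> (T x *v \<xi> + h x) - w * \<theta> - \<alpha> * \<tau>" for \<xi> lam \<tau> \<theta>
    unfolding a by (simp add: inner_outer_product inner_add_right inner_commute)
  have "Z_fun nrm \<Xi> \<xi>0 p Y q0 Q W0 W T h x \<alpha> w = (SUP z\<in>closure (convex hull ?Z). ereal (a \<bullet> z))"
    unfolding Z_fun_def by (intro SUP_cong refl) (auto simp: a)
  also have "\<dots> = (SUP z\<in>?Z. ereal (a \<bullet> z))"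
    by (rule SUP_inner_closure_convex_hull)
  also have "\<dots> = ereal (Max (g ` \<Xi>))"
  proof (rule antisym)
    show "(SUP z\<in>?Z. ereal (a \<bullet> z)) \<le> ereal (Max (g ` \<Xi>))"
    proof (rule SUP_least)
      fix z assume "z \<in> ?Z"
      obtain \<xi> lam Lam \<tau> \<theta> where z: "z = (\<xi>, lam, Lam, \<tau>, \<theta>)" by (cases z)
      have mem: "\<xi> \<in> \<Xi>" "\<And>l. 0 \<le> lam $ l" "0 \<le> \<theta>" "\<theta> \<le> 1 / p" "Lam = (\<chi> l j. lam $ l * \<xi> $ j)"
        "nrm (\<xi> - \<xi>0) \<le> \<tau>" "\<And>y. y \<in> Y \<Longrightarrow> lam \<bullet> (W_of W0 W \<xi> *v y) \<le> \<theta> * (q_of q0 Q \<xi> \<bullet> y)"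
        using \<open>z \<in> ?Z\<close> unfolding z mem_Z_set_iff by auto
      have "a \<bullet> z = lam \<bullet> (T x *v \<xi> + h x) - w * \<theta> - \<alpha> * \<tau>"
        unfolding z mem(5) val ..
      also have "\<dots> \<le> \<theta> * V \<xi> - w * \<theta> - \<alpha> * nrm (\<xi> - \<xi>0)"
        unfolding V_def
        using second_stage_weak_duality[OF fin[OF mem(1)] mem(2,3,7)] mult_left_mono[OF mem(6) \<alpha>]
        by linarith
      also have "\<dots> = \<theta> * (V \<xi> - w) - \<alpha> * nrm (\<xi> - \<xi>0)" by (simp add: algebra_simps)
      also have "\<theta> * (V \<xi> - w) \<le> \<theta> * max (V \<xi> - w) 0"
        using mem(3) by (intro mult_left_mono) auto
      also have "\<dots> \<le> 1 / p * max (V \<xi> - w) 0"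
        using mem(4) by (intro mult_right_mono) auto
      also have "1 / p * max (V \<xi> - w) 0 - \<alpha> * nrm (\<xi> - \<xi>0) \<le> Max (g ` \<Xi>)"
        using \<Xi>(1) mem(1) unfolding g_def by (intro Max_ge) auto
      finally show "ereal (a \<bullet> z) \<le> ereal (Max (g ` \<Xi>))" by simp
    qed
    have "Max (g ` \<Xi>) \<in> g ` \<Xi>" using \<Xi> by (intro Max_in) auto
    then obtain \<xi> where \<xi>: "Max (g ` \<Xi>) = g \<xi>" "\<xi> \<in> \<Xi>" by (rule imageE)
    have "\<exists>z\<in>?Z. g \<xi> \<le> a \<bullet> z"
    \<comment> \<open>The optimal \<open>\<theta>\<close> is an endpoint of its interval:
      \<open>1 / p\<close> with a scaled optimal multiplier if \<open>V \<xi>\<close> reaches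
      \<open>w\<close>, and otherwise zero with the zero multiplier.\<close>
    proof (cases "0 \<le> V \<xi> - w")
      case True
      obtain lam where lam: "\<And>l. 0 \<le> lam $ l" "\<And>y. y \<in> Y \<Longrightarrow> lam \<bullet> (W_of W0 W \<xi> *v y) \<le> q_of q0 Q \<xi> \<bullet> y"
        "V \<xi> \<le> lam \<bullet> (T x *v \<xi> + h x)"
        using second_stage_strong_duality[OF Y slater[OF \<xi>(2)] fin[OF \<xi>(2)]] unfolding V_def by blast
      let ?lam = "(1 / p) *\<^sub>R lam"
      let ?z = "(\<xi>, ?lam, \<chi> l j. ?lam $ l * \<xi> $ j, nrm (\<xi> - \<xi>0), 1 / p)"
      have "?z \<in> ?Z"
        unfolding mem_Z_set_iff using \<xi>(2) lam(1,2) nrm p by (simp add: divide_right_mono)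
      moreover have "g \<xi> \<le> a \<bullet> ?z"
      proof -
        have "g \<xi> = 1 / p * V \<xi> - w * (1 / p) - \<alpha> * nrm (\<xi> - \<xi>0)"
          unfolding g_def using True by (simp add: diff_divide_distrib)
        also have "1 / p * V \<xi> \<le> ?lam \<bullet> (T x *v \<xi> + h x)"
          using lam(3) p by (simp add: divide_right_mono)
        finally show ?thesis unfolding val by simp
      qed
      ultimately show ?thesis by blast
    next
      case False
      let ?z = "(\<xi>, 0, \<chi> l j. 0 $ l * \<xi> $ j, nrm (\<xi> - \<xi>0), 0)"
      have "?z \<in> ?Z"
        unfolding mem_Z_set_iff using \<xi>(2) nrm p by simp
      moreover have "g \<xi> \<le> a \<bullet> ?z" unfolding val g_def using False by simp
      ultimately show ?thesis by blast
    qed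
    then show "ereal (Max (g ` \<Xi>)) \<le> (SUP z\<in>?Z. ereal (a \<bullet> z))"
      unfolding \<xi>(1) by (auto intro: SUP_upper2)
  qed
  finally show ?thesis unfolding g_def V_def .
qed

section \<open>Assembling the equivalence\<close>

text \<open>A finite \<open>a\<close> can be subtracted again in the extended reals, which gives the
  direction not due to monotonicity.\<close>

lemma INF_ereal_add_const:
  fixes f :: "'b \<Rightarrow> ereal"
  assumes "I \<noteq> {}" "\<bar>a\<bar> \<noteq> \<infinity>"
  shows "(INF i\<in>I. a + f i) = a + (INF i\<in>I. f i)"
proof (rule antisym)
  have "(INF i\<in>I. a + f i) - a \<le> (INF i\<in>I. f i)"
  proof (rule INF_greatest)
    fix i assume "i \<in> I"
    then have "(INF i\<in>I. a + f i) \<le> f i + a" by (intro INF_lower2[of i]) (simp_all add: add.commute)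
    then show "(INF i\<in>I. a + f i) - a \<le> f i" by (simp add: ereal_minus_le[OF assms(2)])
  qed
  then show "(INF i\<in>I. a + f i) \<le> a + (INF i\<in>I. f i)"
    by (simp add: ereal_minus_le[OF assms(2)] add.commute)
qed (auto intro!: INF_greatest add_left_mono INF_lower)

lemma set_pmf_empirical: "1 \<le> N \<Longrightarrow> set_pmf (empirical_pmf N xh) = xh ` {1..N}"
  unfolding empirical_pmf_def by (simp add: set_pmf_of_set)

lemma expectation_empirical:
  "1 \<le> N \<Longrightarrow> measure_pmf.expectation (empirical_pmf N xh) f = 1 / real N * (\<Sum>i=1..N. f (xh i))"
  unfolding empirical_pmf_def by (simp add: integral_pmf_of_set)

theorem theorem7:
  fixes X :: "(real^'k) set"
    and c :: "real^'k \<Rightarrow> real"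
    and T :: "real^'k \<Rightarrow> real^'m^'l"
    and h :: "real^'k \<Rightarrow> real^'l"
    and Y :: "(real^'n) set"
    and q0 :: "real^'n" and Q :: "real^'m^'n"
    and W0 :: "real^'n^'l" and W :: "'m \<Rightarrow> real^'n^'l"
    and \<Xi> :: "(real^'m) set"
    and N :: nat and xh :: "nat \<Rightarrow> real^'m"
    and nrm :: "real^'m \<Rightarrow> real"
    and \<epsilon> p :: real
  assumes support: "\<Xi> \<subseteq> binary_vectors"
    and N: "1 \<le> N"
    and observations: "\<And>i. i \<in> {1..N} \<Longrightarrow> xh i \<in> \<Xi>"
    and nrm: "is_norm nrm"
    and \<epsilon>: "0 \<le> \<epsilon>"
    and p: "0 < p" "p \<le> 1"
    and X: "convex X" "compact X"
    and c: "convex_on X c"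
    and h: "\<And>l. closed_proper_convex_on X (\<lambda>x. h x $ l)"
    and T: "\<And>l j. closed_proper_convex_on X (\<lambda>x. T x $ l $ j)"
    and Y: "proper_cone Y"
    and A1: "\<And>\<xi>. \<xi> \<in> \<Xi> \<Longrightarrow> \<exists>y\<in>interior Y. \<forall>l. 0 < (W_of W0 W \<xi> *v y) $ l"
    and A2: "\<And>x \<xi>. x \<in> X \<Longrightarrow> \<xi> \<in> \<Xi> \<Longrightarrow> \<bar>second_stage Y q0 Q W0 W T h x \<xi>\<bar> \<noteq> \<infinity>"
  shows "(\<forall>x\<in>X. \<forall>\<alpha>\<ge>0. \<forall>w. \<forall>i\<in>{1..N}. \<bar>Z_fun nrm \<Xi> (xh i) p Y q0 Q W0 W T h x \<alpha> w\<bar> \<noteq> \<infinity>) \<and>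
    (\<forall>x\<in>X. dro_objective nrm \<Xi> N xh \<epsilon> p Y q0 Q W0 W T h c x =
       (INF (\<alpha>, w)\<in>{0..} \<times> UNIV.
          reformulated_objective nrm \<Xi> N xh \<epsilon> p Y q0 Q W0 W T h c x \<alpha> w)) \<and>
    (INF x\<in>X. dro_objective nrm \<Xi> N xh \<epsilon> p Y q0 Q W0 W T h c x) =
       (INF (x, \<alpha>, w)\<in>X \<times> {0..} \<times> UNIV.
          reformulated_objective nrm \<Xi> N xh \<epsilon> p Y q0 Q W0 W T h c x \<alpha> w)"
proof (intro conjI ballI allI impI)
  have fin: "finite \<Xi>" using finite_binary_vectors support by (rule finite_subset[rotated])
  \<comment> \<open>The first observation, present because \<open>1 \<le> N\<close>, keeps the
    maxima below over nonempty sets.\<close>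
  have ne: "\<Xi> \<noteq> {}" using observations[of 1] N by auto
  have nrm_nonneg: "\<And>v. 0 \<le> nrm v" using nrm unfolding is_norm_def by blast
  define V where "V x \<xi> = real_of_ereal (second_stage Y q0 Q W0 W T h x \<xi>)" for x \<xi>
  \<comment> \<open>The common middle term: the value of \<open>Z_fun\<close> at
    \<open>\<xi>0\<close>, and also the integrand of the Wasserstein dual.\<close>
  define m where "m x \<alpha> w \<xi>0 =
    Max ((\<lambda>\<xi>. 1 / p * max (V x \<xi> - w) 0 - \<alpha> * nrm (\<xi> - \<xi>0)) ` \<Xi>)" for x \<alpha> w \<xi>0
  have Z: "Z_fun nrm \<Xi> \<xi>0 p Y q0 Q W0 W T h x \<alpha> w = ereal (m x \<alpha> w \<xi>0)"
    if "x \<in> X" "0 \<le> \<alpha>" for x \<alpha> w \<xi>0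
    unfolding m_def V_def by (rule Z_fun_eq_Max) (use fin ne nrm_nonneg p that Y A1 A2 in auto)
  show "\<bar>Z_fun nrm \<Xi> (xh i) p Y q0 Q W0 W T h x \<alpha> w\<bar> \<noteq> \<infinity>" if "x \<in> X" "0 \<le> \<alpha>" for x \<alpha> w i
    using Z[OF that] by simp
  show eq: "dro_objective nrm \<Xi> N xh \<epsilon> p Y q0 Q W0 W T h c x =
      (INF (\<alpha>, w)\<in>{0..} \<times> UNIV. reformulated_objective nrm \<Xi> N xh \<epsilon> p Y q0 Q W0 W T h c x \<alpha> w)"
    if x: "x \<in> X" for x
  proof -
    let ?\<mu> = "empirical_pmf N xh"
    let ?\<phi> = "\<lambda>\<alpha> w. \<alpha> * \<epsilon> + w + measure_pmf.expectation ?\<mu> (m x \<alpha> w)"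
    have supp: "set_pmf ?\<mu> \<subseteq> \<Xi>" using N observations by (auto simp: set_pmf_empirical)
    have "(SUP P\<in>ambiguity_set nrm \<Xi> N xh \<epsilon>. cvar P p (V x)) =
        (INF (\<alpha>, w)\<in>{0..} \<times> UNIV. ereal (?\<phi> \<alpha> w))"
      unfolding ambiguity_set_def m_def
      by (rule cvar_wasserstein_duality[OF fin supp]) (use nrm_nonneg p in auto)
    then have "dro_objective nrm \<Xi> N xh \<epsilon> p Y q0 Q W0 W T h c x =
        ereal (c x) + (INF (\<alpha>, w)\<in>{0..} \<times> UNIV. ereal (?\<phi> \<alpha> w))"
      unfolding dro_objective_def V_def by simp
    also have "\<dots> = (INF z\<in>{0..} \<times> UNIV. ereal (c x) + (case z of (\<alpha>, w) \<Rightarrow> ereal (?\<phi> \<alpha> w)))"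
      by (rule INF_ereal_add_const[symmetric]) auto
    also have "\<dots> = (INF (\<alpha>, w)\<in>{0..} \<times> UNIV.
        reformulated_objective nrm \<Xi> N xh \<epsilon> p Y q0 Q W0 W T h c x \<alpha> w)"
    proof (intro INF_cong refl, clarify)
      fix \<alpha> w :: real assume "0 \<le> \<alpha>"
      then show "ereal (c x) + ereal (?\<phi> \<alpha> w) =
          reformulated_objective nrm \<Xi> N xh \<epsilon> p Y q0 Q W0 W T h c x \<alpha> w"
        unfolding reformulated_objective_def Z[OF x \<open>0 \<le> \<alpha>\<close>] expectation_empirical[OF N] by simp
    qed
    finally show ?thesis .
  qed
  show "(INF x\<in>X. dro_objective nrm \<Xi> N xh \<epsilon> p Y q0 Q W0 W T h c x) =
      (INF (x, \<alpha>, w)\<in>X \<times> {0..} \<times> UNIV.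
        reformulated_objective nrm \<Xi> N xh \<epsilon> p Y q0 Q W0 W T h c x \<alpha> w)"
  \<comment> \<open>The joint infimum is compared with the iterated one, whose inner infimum over
    \<open>(\<alpha>, w)\<close> is given by \<open>eq\<close>.\<close>
  proof (rule antisym)
    show "(INF x\<in>X. dro_objective nrm \<Xi> N xh \<epsilon> p Y q0 Q W0 W T h c x) \<le>
        (INF (x, \<alpha>, w)\<in>X \<times> {0..} \<times> UNIV.
          reformulated_objective nrm \<Xi> N xh \<epsilon> p Y q0 Q W0 W T h c x \<alpha> w)"
    proof (rule INF_greatest, clarify)
      fix x and \<alpha> w :: real assume x: "x \<in> X" and "0 \<le> \<alpha>"
      have "dro_objective nrm \<Xi> N xh \<epsilon> p Y q0 Q W0 W T h c x \<le>
          reformulated_objective nrm \<Xi> N xh \<epsilon> p Y q0 Q W0 W T h c x \<alpha> w"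
        unfolding eq[OF x] by (rule INF_lower2[of "(\<alpha>, w)"]) (use \<open>0 \<le> \<alpha>\<close> in auto)
      then show "(INF x\<in>X. dro_objective nrm \<Xi> N xh \<epsilon> p Y q0 Q W0 W T h c x) \<le>
          reformulated_objective nrm \<Xi> N xh \<epsilon> p Y q0 Q W0 W T h c x \<alpha> w"
        by (rule INF_lower2[OF x])
    qed
    show "(INF (x, \<alpha>, w)\<in>X \<times> {0..} \<times> UNIV.
          reformulated_objective nrm \<Xi> N xh \<epsilon> p Y q0 Q W0 W T h c x \<alpha> w) \<le>
        (INF x\<in>X. dro_objective nrm \<Xi> N xh \<epsilon> p Y q0 Q W0 W T h c x)"
    proof (rule INF_greatest)
      fix x assume x: "x \<in> X"
      show "(INF (x, \<alpha>, w)\<in>X \<times> {0..} \<times> UNIV.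
          reformulated_objective nrm \<Xi> N xh \<epsilon> p Y q0 Q W0 W T h c x \<alpha> w) \<le>
          dro_objective nrm \<Xi> N xh \<epsilon> p Y q0 Q W0 W T h c x"
        unfolding eq[OF x]
      proof (rule INF_greatest, clarify)
        fix \<alpha> w :: real assume "0 \<le> \<alpha>"
        then show "(INF (x, \<alpha>, w)\<in>X \<times> {0..} \<times> UNIV.
            reformulated_objective nrm \<Xi> N xh \<epsilon> p Y q0 Q W0 W T h c x \<alpha> w) \<le>
            reformulated_objective nrm \<Xi> N xh \<epsilon> p Y q0 Q W0 W T h c x \<alpha> w"
          by (intro INF_lower2[of "(x, \<alpha>, w)"]) (use x in auto)
      qed
    qed
  qed
qed

end
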